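(* Let $n,k,l\ge 0$ be integers. The group $\mathcal{K}_{n,k,l}$ is generated by the finite set \begin{align*} S_K =\;& \{M_{x^{\epsilon},y} \mid x \in X,\ y \in Y,\ \epsilon = \pm 1\}\cup \{C_{z,y} \mid z \in Z,\ y \in Y\}\\ &\cup \{C_{y,v} \mid y \in Y,\ v \in X \cup Y \cup Z,\ y \neq v\}. \end{align*}
   Context: $F_{n,k,l}$ is the free group on the $n+k+l$ letters $X\cup Y\cup Z$, where $X=\{x_1,\ldots,x_n\}$, $Y=\{y_1,\ldots,y_k\}$, $Z=\{z_1,\ldots,z_l\}$. For a group element $g$, $[[g]]$ denotes its conjugacy class. Define $$\mathcal{A}_{n,k,l}=\{f\in \mathrm{Aut}(F_{n,k,l}) \mid [[f(v)]]=[[v]] \text{ for all } v\in Y\cup Z\}.$$ Let $N$ be the normal closure of $Y$ in $F_{n,k,l}$, and identify $F_{n,k,l}/N$ with $F_{n,0,l}$ (the free group on $X\cup Z$). Every $f\in\mathcal{A}_{n,k,l}$ preserves $N$, so there is an induced homomorphism $\rho\colon\mathcal{A}_{n,k,l}\to\mathcal{A}_{n,0,l}$; it is a split surjection. Define $\mathcal{K}_{n,k,l}=\ker(\rho)$. Automorphisms act on the left and compose right to left. For distinct $v,w\in X\cup Y\cup Z$ and $\epsilon=\pm1$, the automorphism $M_{v^{\epsilon},w}$ of $F_{n,k,l}$ fixes every letter other than $v$ and sends $v\mapsto wv$ if $\epsilon=1$ and $v\mapsto vw^{-1}$ if $\epsilon=-1$; the automorphism $C_{v,w}$ fixes every letter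 other than $v$ and sends $v\mapsto wvw^{-1}$. *)

theory Defs
  imports "HOL-Algebra.Generated_Groups" "HOL-Algebra.Bij"
begin

section \<open>Free groups as groups of reduced words\<close>

text \<open>A word is a list of signed letters: \<open>(a, True)\<close> stands for \<open>a\<close> and \<open>(a, False)\<close> for the
  inverse of \<open>a\<close>.\<close>

type_synonym 'a word = "('a \<times> bool) list"

definition cancels :: "'a \<times> bool \<Rightarrow> 'a \<times> bool \<Rightarrow> bool" where
  "cancels s t \<longleftrightarrow> fst s = fst t \<and> snd s \<noteq> snd t"

definition reduced :: "'a word \<Rightarrow> bool" where
  "reduced w \<longleftrightarrow> successively (\<lambda>s t. \<not> cancels s t) w"

fun push :: "'a \<times> bool \<Rightarrow> 'a word \<Rightarrow> 'a word" where
  "push s [] = [s]"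
| "push s (t # w) = (if cancels s t then w else s # t # w)"

definition reduce :: "'a word \<Rightarrow> 'a word" where
  "reduce w = foldr push w []"

definition free_group :: "'a set \<Rightarrow> 'a word monoid" where
  "free_group S =
    \<lparr>carrier = {w. fst ` set w \<subseteq> S \<and> reduced w},
     mult = \<lambda>u v. reduce (u @ v),
     one = []\<rparr>"

definition gen :: "'a \<Rightarrow> 'a word" where
  "gen a = [(a, True)]"

text \<open>\<open>eval_word G \<phi>\<close> evaluates a word in \<open>G\<close>, sending the letter \<open>a\<close> to \<open>\<phi> a\<close>; accordingly
  \<open>endo S \<phi>\<close> is the endomorphism of the free group on \<open>S\<close> with \<open>a \<mapsto> \<phi> a\<close> for \<open>a \<in> S\<close>. It is
  extensional, as the elements of \<^const>\<open>auto\<close> are.\<close>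

definition eval_word :: "('b, 'm) monoid_scheme \<Rightarrow> ('a \<Rightarrow> 'b) \<Rightarrow> 'a word \<Rightarrow> 'b" where
  "eval_word G \<phi> w =
    foldr (\<lambda>s g. (if snd s then \<phi> (fst s) else inv\<^bsub>G\<^esub> \<phi> (fst s)) \<otimes>\<^bsub>G\<^esub> g) w \<one>\<^bsub>G\<^esub>"

definition endo :: "'a set \<Rightarrow> ('a \<Rightarrow> 'a word) \<Rightarrow> 'a word \<Rightarrow> 'a word" where
  "endo S \<phi> = restrict (eval_word (free_group S) \<phi>) (carrier (free_group S))"

section \<open>Conjugacy classes and normal closures\<close>

definition conj_class :: "('a, 'b) monoid_scheme \<Rightarrow> 'a \<Rightarrow> 'a set" where
  "conj_class G g = {h \<otimes>\<^bsub>G\<^esub> g \<otimes>\<^bsub>G\<^esub> inv\<^bsub>G\<^esub> h | h. h \<in> carrier G}"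

definition normal_closure :: "('a, 'b) monoid_scheme \<Rightarrow> 'a set \<Rightarrow> 'a set" where
  "normal_closure G R = \<Inter>{H. H \<lhd> G \<and> R \<subseteq> H}"

section \<open>The groups \<open>F\<close>, \<open>\<A>\<close> and \<open>\<K>\<close>\<close>

datatype letter = LX nat | LY nat | LZ nat

definition Xs :: "nat \<Rightarrow> letter set" where "Xs n = LX ` {1..n}"
definition Ys :: "nat \<Rightarrow> letter set" where "Ys k = LY ` {1..k}"
definition Zs :: "nat \<Rightarrow> letter set" where "Zs l = LZ ` {1..l}"

definition letters :: "nat \<Rightarrow> nat \<Rightarrow> nat \<Rightarrow> letter set" where
  "letters n k l = Xs n \<union> Ys k \<union> Zs l"

definition F_nkl :: "nat \<Rightarrow> nat \<Rightarrow> nat \<Rightarrow> letter word monoid" where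
  "F_nkl n k l = free_group (letters n k l)"

definition A_nkl :: "nat \<Rightarrow> nat \<Rightarrow> nat \<Rightarrow> (letter word \<Rightarrow> letter word) monoid" where
  "A_nkl n k l = (AutoGroup (F_nkl n k l))
    \<lparr>carrier := {f \<in> auto (F_nkl n k l).
       \<forall>v \<in> Ys k \<union> Zs l. conj_class (F_nkl n k l) (f (gen v)) = conj_class (F_nkl n k l) (gen v)}\<rparr>"

definition N_nkl :: "nat \<Rightarrow> nat \<Rightarrow> nat \<Rightarrow> letter word set" where
  "N_nkl n k l = normal_closure (F_nkl n k l) (gen ` Ys k)"

text \<open>The identification of \<open>F_nkl n 0 l\<close> with the quotient of \<open>F_nkl n k l\<close> by \<open>N_nkl n k l\<close>: since
  \<open>letters n 0 l \<subseteq> letters n k l\<close>, words in \<open>F_nkl n 0 l\<close> are words in \<open>F_nkl n k l\<close>, and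
  \<open>iota n k l\<close> is this inclusion followed by the quotient map.\<close>

definition iota :: "nat \<Rightarrow> nat \<Rightarrow> nat \<Rightarrow> letter word \<Rightarrow> letter word set" where
  "iota n k l = (\<lambda>w \<in> carrier (F_nkl n 0 l). N_nkl n k l #>\<^bsub>F_nkl n k l\<^esub> w)"

text \<open>An automorphism \<open>f\<close> preserving \<open>N_nkl n k l\<close> acts on the quotient by taking images of cosets;
  \<open>rho n k l f\<close> is this action transported along \<open>iota n k l\<close>.\<close>

definition rho :: "nat \<Rightarrow> nat \<Rightarrow> nat \<Rightarrow> (letter word \<Rightarrow> letter word) \<Rightarrow> letter word \<Rightarrow> letter word" where
  "rho n k l f = (\<lambda>w \<in> carrier (F_nkl n 0 l).
     inv_into (carrier (F_nkl n 0 l)) (iota n k l) (f ` iota n k l w))"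

definition K_nkl :: "nat \<Rightarrow> nat \<Rightarrow> nat \<Rightarrow> (letter word \<Rightarrow> letter word) monoid" where
  "K_nkl n k l = (A_nkl n k l)\<lparr>carrier := kernel (A_nkl n k l) (A_nkl n 0 l) (rho n k l)\<rparr>"

section \<open>The generators\<close>

text \<open>\<open>M_aut S v \<epsilon> w\<close> is meant for \<open>\<epsilon> = 1\<close> and \<open>\<epsilon> = -1\<close> only.\<close>

definition M_aut :: "'a set \<Rightarrow> 'a \<Rightarrow> int \<Rightarrow> 'a \<Rightarrow> 'a word \<Rightarrow> 'a word" where
  "M_aut S v \<epsilon> w = endo S ((\<lambda>u. gen u)
     (v := if \<epsilon> = 1 then gen w \<otimes>\<^bsub>free_group S\<^esub> gen v
           else gen v \<otimes>\<^bsub>free_group S\<^esub> inv\<^bsub>free_group S\<^esub> gen w))"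

definition C_aut :: "'a set \<Rightarrow> 'a \<Rightarrow> 'a \<Rightarrow> 'a word \<Rightarrow> 'a word" where
  "C_aut S v w = endo S ((\<lambda>u. gen u)
     (v := gen w \<otimes>\<^bsub>free_group S\<^esub> gen v \<otimes>\<^bsub>free_group S\<^esub> inv\<^bsub>free_group S\<^esub> gen w))"

definition S_K :: "nat \<Rightarrow> nat \<Rightarrow> nat \<Rightarrow> (letter word \<Rightarrow> letter word) set" where
  "S_K n k l =
     {M_aut (letters n k l) x \<epsilon> y | x y \<epsilon>. x \<in> Xs n \<and> y \<in> Ys k \<and> \<epsilon> \<in> {1, -1}}
     \<union> {C_aut (letters n k l) z y | z y. z \<in> Zs l \<and> y \<in> Ys k}
     \<union> {C_aut (letters n k l) y v | y v. y \<in> Ys k \<and> v \<in> letters n k l \<and> y \<noteq> v}"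

end

theory Submission
  imports Defs "HOL-Library.Sublist"
begin

text \<open>
  Let \<open>V\<close> be the union of the three kinds of letters and \<open>F\<close> the free group on \<open>V\<close>. Killing the
  letters of \<open>Y\<close> is a retraction of \<open>F\<close> onto the subgroup of words in \<open>X\<close> and \<open>Z\<close>, its kernel is
  the normal closure of \<open>Y\<close> (\<open>normal_closure_eq\<close>), and so an automorphism \<open>f\<close> in \<open>\<A>\<close> lies in \<open>\<K>\<close>
  exactly if \<open>f w\<close> retracts to \<open>w\<close> for every word \<open>w\<close> in \<open>X\<close> and \<open>Z\<close> (\<open>quotient_action\<close>).

  Let \<open>H\<close>, called \<open>move_group\<close> below, be the subgroup generated by the proposed generators; it
  lies in \<open>\<K>\<close> by inspection. For the converse, call \<open>g\<close> a base normalizer if it fixes \<open>Y\<close>, maps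
  words in \<open>X\<close> and \<open>Z\<close> to such words, and satisfies \<open>g H inv(g) \<subseteq> H\<close>. It suffices to write every
  \<open>f\<close> in \<open>\<A>\<close> as \<open>h g\<close> with \<open>h\<close> in \<open>H\<close> and a base normalizer \<open>g\<close> (\<open>factorization\<close>): if \<open>f\<close> is in
  \<open>\<K>\<close>, then so is \<open>g\<close>, and \<open>g w\<close>, being a word in \<open>X\<close> and \<open>Z\<close> that retracts to \<open>w\<close>, equals \<open>w\<close>;
  hence \<open>g\<close> is the identity and \<open>f = h\<close>.

  The factorization rests on two facts.

  \<^item> \<open>\<A>\<close> is generated by elementary automorphisms (multiply a letter of \<open>X\<close> on one side by a
    letter, or conjugate any letter by another one) and by the automorphisms that permute and
    invert the letters of \<open>X\<close>. This is Nielsen's method: precomposing \<open>f\<close> with an elementary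
    automorphism changes one entry of the tuple of images of the letters. If no such change makes
    the tuple smaller, then in a product of images no factor is cancelled completely, so every
    letter, being such a product of length one, is itself an image. The letters of \<open>Y\<close> and \<open>Z\<close> may
    only be conjugated, but as their images are conjugates of letters, of odd length, conjugation
    suffices wherever Nielsen's argument multiplies such an image.

  \<^item> An elementary automorphism that involves \<open>Y\<close> is in \<open>H\<close>, and the others are base normalizers
    (\<open>elementary_inverse\<close>). The point is that \<open>H\<close> contains more than its generators show: it
    contains \<open>b \<mapsto> n b n'\<close> for \<open>b\<close> in \<open>X\<close> and all \<open>n\<close> and \<open>n'\<close> in the normal closure of \<open>Y\<close> that do
    not involve \<open>b\<close>, and for \<open>b\<close> in \<open>Z\<close> likewise if \<open>n'\<close> is the inverse of \<open>n\<close>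
    (\<open>transv_in_move_group\<close>), and conjugating a generator by an elementary automorphism that does
    not involve \<open>Y\<close> leads only to such automorphisms, to generators, and to conjugations of
    letters of \<open>Y\<close> (\<open>transv_base_normalizer\<close>).
\<close>

section \<open>Words and their reduction\<close>

definition flip :: "'a \<times> bool \<Rightarrow> 'a \<times> bool" where
  "flip s = (fst s, \<not> snd s)"

definition winv :: "'a word \<Rightarrow> 'a word" where
  "winv w = rev (map flip w)"

lemma flip_flip [simp]: "flip (flip s) = s"
  and fst_flip [simp]: "fst (flip s) = fst s"
  and flip_neq [simp]: "flip s \<noteq> s" "s \<noteq> flip s"
  by (cases s; simp add: flip_def; fail)+

lemma flip_inject [simp]: "flip s = flip t \<longleftrightarrow> s = t"
  by (metis flip_flip)

lemma same_letter: "fst s = fst t \<Longrightarrow> t \<noteq> flip s \<Longrightarrow> t = s"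
  by (cases s; cases t) (auto simp: flip_def)

lemma cancels_iff: "cancels s t \<longleftrightarrow> t = flip s"
  by (cases s; cases t) (auto simp: cancels_def flip_def)

lemma winv_simps [simp]:
  "winv [] = []" "winv (s # w) = winv w @ [flip s]" "winv (u @ v) = winv v @ winv u"
  "winv (winv w) = w" "length (winv w) = length w" "fst ` set (winv w) = fst ` set w"
  "winv w = [] \<longleftrightarrow> w = []"
  by (auto simp: winv_def rev_map o_def image_image)

lemma winv_inject [simp]: "winv u = winv v \<longleftrightarrow> u = v"
  by (metis winv_simps(4))

lemma last_winv: "w \<noteq> [] \<Longrightarrow> last (winv w) = flip (hd w)"
  by (simp add: winv_def last_rev hd_map)

lemma reduced_Nil [simp]: "reduced []"
  and reduced_single [simp]: "reduced [s]"
  by (simp_all add: reduced_def)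

lemma reduced_Cons: "reduced (s # w) \<longleftrightarrow> reduced w \<and> (w = [] \<or> hd w \<noteq> flip s)"
  by (auto simp: reduced_def successively_Cons cancels_iff)

lemma reduced_append:
  "reduced (u @ v) \<longleftrightarrow> reduced u \<and> reduced v \<and> (u = [] \<or> v = [] \<or> hd v \<noteq> flip (last u))"
  by (auto simp: reduced_def successively_append_iff cancels_iff)

lemma reduced_winv [simp]: "reduced (winv w) \<longleftrightarrow> reduced w"
proof -
  have "cancels (flip y) (flip x) \<longleftrightarrow> cancels x y" for x y :: "'a \<times> bool"
    by (auto simp: cancels_iff)
  then show ?thesis
    by (simp add: winv_def reduced_def successively_map)
qed

lemma push_eq: "push s w = (if w \<noteq> [] \<and> hd w = flip s then tl w else s # w)"
  by (cases w) (auto simp: cancels_iff)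

lemma reduced_push: "reduced w \<Longrightarrow> reduced (push s w)"
  by (cases w) (auto simp: cancels_iff reduced_Cons)

lemma reduced_foldr_push: "reduced w \<Longrightarrow> reduced (foldr push u w)"
  by (induction u) (auto simp: reduced_push)

lemma reduced_reduce [simp]: "reduced (reduce w)"
  by (simp add: reduce_def reduced_foldr_push)

lemma reduce_reduced [simp]: "reduced w \<Longrightarrow> reduce w = w"
proof (induction w)
  case (Cons s w)
  then show ?case
    by (auto simp: reduce_def reduced_Cons push_eq)
qed (simp add: reduce_def)

lemma push_flip: "reduced w \<Longrightarrow> push s (push (flip s) w) = w"
  by (cases w) (auto simp: push_eq reduced_Cons)

text \<open>Pushing the letters of a word one by one is an action of the free monoid on reduced words.
  This lemma says that it factors through \<open>push\<close>, which is what makes reduction independent of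
  bracketing and hence the multiplication of the free group associative.\<close>
lemma foldr_push_push:
  assumes "reduced r" "reduced w"
  shows "foldr push (push s r) w = push s (foldr push r w)"
proof (cases "r \<noteq> [] \<and> hd r = flip s")
  case True
  then obtain r' where "r = flip s # r'"
    by (cases r) auto
  with assms show ?thesis
    by (simp add: cancels_iff push_flip reduced_foldr_push)
next
  case False
  then have "push s r = s # r"
    by (simp only: push_eq if_False)
  then show ?thesis
    by simp
qed

lemma reduce_append: "reduce (u @ v) = foldr push u (reduce v)"
  by (simp add: reduce_def)

lemma reduce_reduce_right [simp]: "reduce (u @ reduce v) = reduce (u @ v)"
  by (simp add: reduce_append)

lemma reduce_reduce_left [simp]: "reduce (reduce u @ v) = reduce (u @ v)"
proof (induction u)
  case (Cons s u)
  have "reduce (reduce (s # u) @ v) = foldr push (push s (reduce u)) (reduce v)"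
    by (simp add: reduce_append) (simp add: reduce_def)
  also have "\<dots> = push s (reduce (reduce u @ v))"
    by (simp add: foldr_push_push reduce_append)
  finally show ?case
    using Cons by (simp add: reduce_def)
qed (simp add: reduce_def)

lemma reduce_Cons: "reduce (s # v) = push s (reduce v)"
  by (simp add: reduce_def)

lemma reduce_cancel_left: "reduce (c @ winv c @ v) = reduce v"
  by (induction c arbitrary: v) (simp_all add: reduce_Cons push_flip)

lemma reduce_cancel: "reduce (u @ c @ winv c @ v) = reduce (u @ v)"
  by (metis reduce_append reduce_cancel_left)

lemma reduce_cancel': "reduce (u @ winv c @ c @ v) = reduce (u @ v)"
  using reduce_cancel[of u "winv c" v] by simp

lemma length_reduce: "length (reduce w) \<le> length w"
proof (induction w)
  case (Cons s w)
  then show ?case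
    by (auto simp: reduce_Cons push_eq)
qed (simp add: reduce_def)

lemma set_reduce: "set (reduce w) \<subseteq> set w"
proof (induction w)
  case (Cons s w)
  have "set (push s r) \<subseteq> insert s (set r)" for r :: "'a word"
    by (cases r) auto
  with Cons show ?case
    by (fastforce simp: reduce_Cons)
qed (simp add: reduce_def)

lemma letters_reduce: "fst ` set w \<subseteq> S \<Longrightarrow> fst ` set (reduce w) \<subseteq> S"
  using set_reduce[of w] by blast

lemma winv_reduce: "winv (reduce w) = reduce (winv w)"
proof -
  have "reduce (winv w) = reduce (winv w @ reduce w @ winv (reduce w))"
    using reduce_cancel[of "winv w" "reduce w" "[]"] by simp
  also have "\<dots> = reduce (reduce (winv w @ reduce w) @ winv (reduce w))"
    by (simp only: reduce_reduce_left append_assoc)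
  also have "reduce (winv w @ reduce w) = []"
    using reduce_cancel'[of "[]" w "[]"] by (simp add: reduce_def[of "[]"])
  finally show ?thesis
    by simp
qed

section \<open>Cancellation in a product of two reduced words\<close>

text \<open>As a longest common prefix, the cancelled part is maximal by construction, and its behaviour
  under inversion is the symmetry of common prefixes (\<open>overlap_winv\<close>).\<close>
definition overlap :: "'a word \<Rightarrow> 'a word \<Rightarrow> 'a word" where
  "overlap u v = longest_common_prefix (winv u) v"

lemma overlap_split:
  assumes "reduced u" "reduced v"
  obtains u' v' where "u = u' @ winv (overlap u v)" "v = overlap u v @ v'"
    "reduced (u' @ v')" "reduce (u @ v) = u' @ v'"
proof -
  define k where "k = overlap u v"
  obtain a where a: "winv u = k @ a"
    using longest_common_prefix_prefix1 unfolding k_def overlap_def by (metis prefix_def)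
  obtain v' where v': "v = k @ v'"
    using longest_common_prefix_prefix2 unfolding k_def overlap_def by (metis prefix_def)
  have u: "u = winv a @ winv k"
    using a by (metis winv_simps(3,4))
  have "hd v' \<noteq> flip (last (winv a))" if ne: "a \<noteq> []" "v' \<noteq> []"
  proof
    assume "hd v' = flip (last (winv a))"
    then have "hd v' = hd a"
      using ne by (simp add: last_winv)
    then have "prefix (k @ [hd a]) (winv u)" "prefix (k @ [hd a]) v"
      using ne a v' by (metis append_Cons append_Nil hd_Cons_tl prefixI same_prefix_prefix)+
    then have "prefix (k @ [hd a]) k"
      unfolding k_def overlap_def by (rule longest_common_prefix_max_prefix)
    then show False
      by (metis length_append_singleton not_less_eq_eq order_refl prefix_length_le)
  qed
  then have red: "reduced (winv a @ v')"
    using assms u v' by (auto simp: reduced_append)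
  moreover have "reduce (u @ v) = reduce (winv a @ v')"
    using u v' reduce_cancel'[of "winv a" k v'] by simp
  ultimately show thesis
    using that[of "winv a" v'] u v' unfolding k_def by simp
qed

lemma overlap_winv: "overlap (winv v) (winv u) = overlap u v"
proof -
  have "longest_common_prefix x y = longest_common_prefix y x" for x y :: "'a word"
    by (induction x y rule: longest_common_prefix.induct) auto
  then show ?thesis
    by (simp add: overlap_def)
qed

text \<open>If more than half of \<open>u\<close> were cancelled by \<open>u\<close> itself, then \<open>u\<close> would agree with its own
  inverse around its middle: its middle letter would be its own inverse, or its two middle letters
  would be inverse to each other.\<close>

lemma overlap_self:
  assumes "reduced u"
  shows "2 * length (overlap u u) \<le> length u"
proof (rule ccontr)
  define k where "k = overlap u u"
  assume "\<not> ?thesis"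
  then have big: "2 * length k > length u"
    by (simp add: k_def)
  obtain u' v' where *: "u = u' @ winv k" "u = k @ v'"
    using overlap_split[OF assms assms] unfolding k_def by metis
  then have len: "length u' = length v'" "length u = length k + length u'"
    by (metis add_right_cancel length_append winv_simps(5) add.commute)+
  have mirror: "u ! i = flip (u ! (length u - 1 - i))" if "i < length k" for i
  proof -
    have "length u - 1 - i = length u' + (length k - 1 - i)"
      using len that by simp
    then have "u ! (length u - 1 - i) = winv k ! (length k - 1 - i)"
      using *(1) by (metis nth_append_length_plus)
    also have "\<dots> = flip (k ! i)"
      using that by (simp add: winv_def rev_nth)
    also have "k ! i = u ! i"
      using *(2) that by (metis nth_append)
    finally show ?thesis
      by simp
  qed
  show False
  proof (cases "even (length u)")
    case True
    then obtain m where m: "length u = 2 * m"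
      by (elim evenE)
    define i where "i = m - 1"
    have i: "i < length k" "length u - 1 - i = Suc i" "Suc i < length u"
      using m big len(2) by (auto simp: i_def)
    then have "u ! i = flip (u ! Suc i)"
      using mirror by metis
    moreover have "\<not> cancels (u ! i) (u ! Suc i)"
      using assms i(3) unfolding reduced_def by (rule successively_nth)
    ultimately show False
      by (simp add: cancels_iff)
  next
    case False
    then have "length u div 2 < length k" "length u - 1 - length u div 2 = length u div 2"
      using big by (auto elim!: oddE)
    then show False
      using mirror flip_neq by metis
  qed
qed

section \<open>Tuples of words that are minimal under elementary moves\<close>

lemma append_eq_prefix:
  assumes "xs @ ys = zs @ ts" "length xs \<le> length zs"
  obtains us where "zs = xs @ us" "ys = us @ ts"
  using assms by (metis append_eq_append_conv2 append_eq_append_conv_if append_take_drop_id)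

lemma reduce_eq_if_length_eq: "length (reduce w) = length w \<Longrightarrow> reduce w = w"
proof (induction w)
  case (Cons s w)
  show ?case
  proof (cases "reduce w \<noteq> [] \<and> hd (reduce w) = flip s")
    case True
    then have "length (reduce (s # w)) < Suc (length (reduce w))"
      by (simp add: reduce_Cons push_eq)
    with Cons.prems length_reduce[of w] show ?thesis
      by simp
  next
    case False
    then have "reduce (s # w) = s # reduce w"
      unfolding reduce_Cons push_eq by (simp only: if_False)
    with Cons show ?thesis
      by simp
  qed
qed (simp add: reduce_def)

definition half :: "'a word \<Rightarrow> 'a word" where
  "half w = take (length w div 2) w"

lemma half_conj: "half (A @ [t] @ winv A) = A"
  by (simp add: half_def)

text \<open>Length alone does not suffice as a measure: a word that is cancelled half by its left and
  half by its right neighbour can be multiplied onto a neighbour without changing any length. Such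
  a move exchanges a prefix, of at most half the length, of the neighbour or of its inverse, and
  so ties are broken by a numbering of these two initial halves. Using both halves makes the
  measure invariant under inversion.\<close>
definition better :: "('a word \<Rightarrow> nat) \<Rightarrow> 'a word \<Rightarrow> 'a word \<Rightarrow> bool" where
  "better num v w \<longleftrightarrow> length v < length w \<or>
     length v = length w \<and> num (half v) + num (half (winv v)) < num (half w) + num (half (winv w))"

lemma betterI_length: "length v < length w \<Longrightarrow> better num v w"
  by (simp add: better_def)

lemma better_winv [simp]: "better num (winv v) (winv w) \<longleftrightarrow> better num v w"
  by (simp add: better_def add.commute)

text \<open>\<open>U s\<close> plays the role of the image of the signed letter \<open>s\<close> under an endomorphism that maps
  each peripheral letter, an element of \<open>P\<close>, to a conjugate of itself. The last two assumptions
  say that no elementary move decreases the measure. The moves are stated for signed letters \<open>t\<close>: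
  for a negative \<open>t\<close>, multiplying \<open>U t\<close> on the left is multiplying the image of the letter on the
  right.\<close>
locale minimal_tuple =
  fixes V P :: "'a set" and U :: "'a \<times> bool \<Rightarrow> 'a word" and num :: "'a word \<Rightarrow> nat"
  assumes num_append: "length d = length e \<Longrightarrow> num d < num e \<Longrightarrow> num (d @ r) < num (e @ r)"
    and num_inj: "length d = length e \<Longrightarrow> fst ` set d \<subseteq> V \<Longrightarrow> fst ` set e \<subseteq> V \<Longrightarrow>
      num d = num e \<Longrightarrow> d = e"
    and U_reduced: "fst s \<in> V \<Longrightarrow> reduced (U s)"
    and U_letters: "fst s \<in> V \<Longrightarrow> fst ` set (U s) \<subseteq> V"
    and U_nonempty: "fst s \<in> V \<Longrightarrow> U s \<noteq> []"
    and U_flip: "fst s \<in> V \<Longrightarrow> U (flip s) = winv (U s)"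
    and U_peripheral: "fst t \<in> P \<Longrightarrow> \<exists>A. U t = A @ [t] @ winv A"
    and mult_not_better: "fst s \<in> V \<Longrightarrow> fst t \<in> V - P \<Longrightarrow> fst s \<noteq> fst t \<Longrightarrow>
      \<not> better num (reduce (U s @ U t)) (U t)"
    and conj_not_better: "fst s \<in> V \<Longrightarrow> fst t \<in> P \<Longrightarrow> fst s \<noteq> fst t \<Longrightarrow>
      \<not> better num (reduce (U s @ U t @ winv (U s))) (U t)"
begin

text \<open>If more than half of \<open>U s\<close> were cancelled by \<open>U t\<close>, some move would shorten an entry.
  Usually the move is to multiply or to conjugate \<open>U t\<close> by \<open>U s\<close>. The exception is a peripheral \<open>U
  t = A t A\<^sup>-\<close>, with \<open>A\<^sup>-\<close> the inverse of \<open>A\<close>, in which the cancellation goes beyond the central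
  letter \<open>t\<close>. Then it removes more than half of \<open>U t\<close> as well, and the roles can be exchanged: if
  \<open>s\<close> is not peripheral, multiply \<open>U s\<close> by \<open>U t\<close>; if \<open>U s = B s B\<^sup>-\<close> is peripheral, then \<open>A\<close> and
  \<open>B\<close> are comparable prefixes of one word, and the entry with the longer one is shortened by
  conjugation. They do not have the same length, because then the central letters would cancel.\<close>
lemma overlap_le_left:
  assumes V: "fst s \<in> V" "fst t \<in> V" and "t \<noteq> flip s"
  shows "2 * length (overlap (U s) (U t)) \<le> length (U s)"
proof (cases "fst s = fst t")
  case True
  then show ?thesis
    using assms same_letter overlap_self U_reduced by metis
next
  case neq: False
  show ?thesis
  proof (rule ccontr)
    define u w c where "u = U s" "w = U t" "c = overlap u w"
    obtain u' w' where u: "u = u' @ winv c" and w: "w = c @ w'" and uw: "reduce (u @ w) = u' @ w'"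
      using overlap_split[of u w] V U_reduced unfolding u_w_c_def by metis
    assume "\<not> ?thesis"
    then have "2 * length c > length u"
      by (simp add: u_w_c_def)
    then have big: "length u' < length c"
      using u by simp
    show False
    proof (cases "fst t \<in> P")
      case False
      have "length (reduce (u @ w)) < length w"
        using uw w big by simp
      then show False
        using mult_not_better[of s t] betterI_length V False neq u_w_c_def by blast
    next
      case tP: True
      obtain A where A: "w = A @ [t] @ winv A"
        using U_peripheral[OF tP] u_w_c_def by blast
      show False
      proof (cases "length c \<le> length A")
        case True
        obtain A' where A': "A = c @ A'"
          using append_eq_prefix[of c w' A] w A True by metis
        have "reduce (u @ w @ winv u)
            = reduce (u' @ winv c @ c @ (A' @ [t] @ winv A' @ winv c @ c @ winv u'))"
          using u A A' by simp
        also have "\<dots> = reduce ((u' @ A' @ [t] @ winv A') @ winv c @ c @ winv u')"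
          using reduce_cancel'[of u' c "A' @ [t] @ winv A' @ winv c @ c @ winv u'"] by simp
        also have "\<dots> = reduce (u' @ A' @ [t] @ winv A' @ winv u')"
          using reduce_cancel'[of "u' @ A' @ [t] @ winv A'" c "winv u'"] by simp
        finally have "length (reduce (u @ w @ winv u)) \<le> length (u' @ A' @ [t] @ winv A' @ winv u')"
          using length_reduce by metis
        also have "\<dots> < length w"
          using A A' big by simp
        finally show False
          using conj_not_better[of s t] betterI_length V tP neq u_w_c_def by blast
      next
        case False
        then have "length (A @ [t]) \<le> length c"
          by simp
        then obtain r where r: "c = (A @ [t]) @ r"
          using append_eq_prefix[of "A @ [t]" "winv A" c w'] w A by (metis append_assoc)
        show False
        proof (cases "fst s \<in> P")
          case False
          have "length (reduce (winv w @ winv u)) = length (u' @ w')"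
            using uw winv_reduce[of "u @ w"] by (metis winv_simps(3,5))
          also have "\<dots> < length (winv u)"
          proof -
            have "length w = 2 * length A + 1" "length c \<ge> length A + 1"
              using A r by simp_all
            then show ?thesis
              using u w by simp
          qed
          finally have "better num (reduce (U (flip t) @ U (flip s))) (U (flip s))"
            using V U_flip betterI_length u_w_c_def by metis
          then show False
            using mult_not_better[of "flip t" "flip s"] V False neq by simp
        next
          case sP: True
          obtain B where B: "u = B @ [s] @ winv B"
            using U_peripheral[OF sP] u_w_c_def by blast
          have wu: "B @ [flip s] @ winv B = (A @ [t]) @ (r @ winv u')"
            using u r B by (metis append_assoc winv_simps append_Nil)
          consider "length B < length A" | "length B = length A" | "length A < length B"
            by linarith
          then show False
          proof cases
            case 1
            then have "length (B @ [flip s]) \<le> length A"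
              by simp
            then obtain A' where A': "A = (B @ [flip s]) @ A'"
              using append_eq_prefix[of "B @ [flip s]" "winv B" A "[t] @ r @ winv u'"] wu
              by (metis append_assoc)
            have uA: "reduce (u @ A @ x) = reduce (B @ A' @ x)" for x
            proof -
              have "reduce (u @ A @ x) = reduce ((B @ [s]) @ winv B @ B @ [flip s] @ A' @ x)"
                using B A' by simp
              also have "\<dots> = reduce (B @ [s] @ winv [s] @ A' @ x)"
                unfolding reduce_cancel' by simp
              finally show ?thesis
                unfolding reduce_cancel .
            qed
            have Au: "reduce (x @ winv A @ winv u) = reduce (x @ winv A' @ winv B)" for x
              using uA[of "winv x"] by (metis append_assoc winv_reduce winv_simps(3,4))
            have "reduce (u @ w @ winv u) = reduce ((B @ A' @ [t]) @ winv A @ winv u)"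
              using uA[of "[t] @ winv A @ winv u"] A by simp
            also have "\<dots> = reduce ((B @ A' @ [t]) @ winv A' @ winv B)"
              by (rule Au)
            finally have "length (reduce (u @ w @ winv u)) \<le> length ((B @ A' @ [t]) @ winv A' @ winv
                B)"
              using length_reduce by metis
            also have "\<dots> < length w"
              using A A' by simp
            finally show False
              using conj_not_better[of s t] betterI_length V tP neq u_w_c_def by blast
          next
            case 2
            then show False
              using wu \<open>t \<noteq> flip s\<close> by simp
          next
            case 3
            then have "length (A @ [t]) \<le> length B"
              by simp
            then obtain B' where B': "B = (A @ [t]) @ B'"
              using append_eq_prefix[of "A @ [t]" "r @ winv u'" B "[flip s] @ winv B"] wu
              by metis
            have wB: "reduce (winv w @ B @ x) = reduce (A @ B' @ x)" for x
            proof -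
              have "reduce (winv w @ B @ x) = reduce ((A @ [flip t]) @ winv A @ A @ [t] @ B' @ x)"
                using A B' by simp
              also have "\<dots> = reduce (A @ [flip t] @ winv [flip t] @ B' @ x)"
                unfolding reduce_cancel' by simp
              finally show ?thesis
                unfolding reduce_cancel .
            qed
            have Bw: "reduce (x @ winv B @ w) = reduce (x @ winv B' @ winv A)" for x
              using wB[of "winv x"] by (metis append_assoc winv_reduce winv_simps(3,4))
            have "reduce (winv w @ u @ w) = reduce ((A @ B' @ [s]) @ winv B @ w)"
              using wB[of "[s] @ winv B @ w"] B by simp
            also have "\<dots> = reduce ((A @ B' @ [s]) @ winv B' @ winv A)"
              by (rule Bw)
            finally have "length (reduce (winv w @ u @ w)) \<le> length ((A @ B' @ [s]) @ winv B' @ winv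
                A)"
              using length_reduce by metis
            also have "\<dots> < length u"
              using B B' by simp
            finally have "better num (reduce (U (flip t) @ U s @ winv (U (flip t)))) (U s)"
              using V U_flip betterI_length u_w_c_def by (metis winv_simps(4))
            then show False
              using conj_not_better[of "flip t" s] V sP neq by simp
          qed
        qed
      qed
    qed
  qed
qed

lemma overlap_le_right:
  assumes "fst s \<in> V" "fst t \<in> V" "t \<noteq> flip s"
  shows "2 * length (overlap (U s) (U t)) \<le> length (U t)"
proof -
  have "2 * length (overlap (U (flip t)) (U (flip s))) \<le> length (U (flip t))"
    using assms by (intro overlap_le_left) auto
  then show ?thesis
    using assms by (simp add: U_flip overlap_winv)
qed

text \<open>The move behind the second component of the measure. If \<open>U s = d c\<^sup>-\<close> has halves of equal
  length, with \<open>c\<^sup>-\<close> the inverse of \<open>c\<close>, and \<open>U t\<close> starts with \<open>c\<close>, then the move by \<open>U s\<close>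
  replaces this \<open>c\<close> by \<open>d\<close> in the initial half of \<open>U t\<close> (for a peripheral \<open>t\<close>, in both halves).\<close>
lemma no_improving_half:
  assumes V: "fst s \<in> V" "fst t \<in> V" and neq: "fst s \<noteq> fst t"
    and s: "U s = d @ winv c" and t: "U t = c @ t'"
    and len: "length d = length c" "2 * length c \<le> length (U t)"
  shows "\<not> num d < num c"
proof
  assume less: "num d < num c"
  show False
  proof (cases "fst t \<in> P")
    case False
    define H where "H = length (U t) div 2"
    have H: "length c \<le> H" "H \<le> length t'"
      using len t by (auto simp: H_def)
    have eq: "reduce (U s @ U t) = reduce (d @ t')"
      using s t reduce_cancel'[of d c t'] by simp
    have "better num (reduce (d @ t')) (U t)"
    proof (cases "length (reduce (d @ t')) < length (d @ t')")
      case True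
      then show ?thesis
        using t len by (intro betterI_length) simp
    next
      case False
      then have "reduce (d @ t') = d @ t'"
        using length_reduce[of "d @ t'"] by (intro reduce_eq_if_length_eq) simp
      moreover have "half (d @ t') = d @ take (H - length c) t'" "half (U t) = c @ take (H - length
          c) t'"
        using H t len by (simp_all add: half_def H_def)
      moreover have "half (winv (d @ t')) = take H (winv t')" "half (winv (U t)) = take H (winv t')"
        using H t len by (simp_all add: half_def H_def add.commute)
      ultimately show ?thesis
        using less len num_append t by (simp add: better_def)
    qed
    then show False
      using mult_not_better[of s t] V False neq eq by simp
  next
    case True
    obtain A where A: "U t = A @ [t] @ winv A"
      using U_peripheral[OF True] by blast
    have "length c \<le> length A"
      using A len by simp
    then obtain A' where A': "A = c @ A'"
      using append_eq_prefix[of c t' A] t A by metis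
    let ?w = "(d @ A') @ [t] @ winv (d @ A')"
    have "reduce (U s @ U t @ winv (U s))
        = reduce (d @ winv c @ c @ (A' @ [t] @ winv A' @ winv c @ c @ winv d))"
      using s A A' by simp
    also have "\<dots> = reduce ((d @ A' @ [t] @ winv A') @ winv c @ c @ winv d)"
      using reduce_cancel'[of d c "A' @ [t] @ winv A' @ winv c @ c @ winv d"] by simp
    also have "\<dots> = reduce ?w"
      using reduce_cancel'[of "d @ A' @ [t] @ winv A'" c "winv d"] by simp
    finally have eq: "reduce (U s @ U t @ winv (U s)) = reduce ?w" .
    have "better num (reduce ?w) (U t)"
    proof (cases "length (reduce ?w) < length ?w")
      case True
      then show ?thesis
        using A A' len by (intro betterI_length) simp
    next
      case False
      then have w: "reduce ?w = ?w"
        using length_reduce[of ?w] by (intro reduce_eq_if_length_eq) simp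
      have "half ?w = d @ A'" "half (U t) = c @ A'"
        unfolding A half_conj A' by simp_all
      moreover have "half (winv ?w) = d @ A'" "half (winv (U t)) = c @ A'"
        using half_conj[of "d @ A'" "flip t"] half_conj[of "c @ A'" "flip t"]
        unfolding A A' by simp_all
      ultimately show ?thesis
        using less len num_append[of d c A'] w A A' by (simp add: better_def)
    qed
    then show False
      using conj_not_better[of s t] V True neq eq by simp
  qed
qed

text \<open>Otherwise \<open>U s\<close> consists of a half \<open>k\<close> that is cancelled by \<open>U r\<close> and a half, the inverse of
  \<open>c\<close>, that is cancelled by \<open>U t\<close>. The two words \<open>k\<close> and \<open>c\<close> differ since \<open>U s\<close> is reduced, so
  they have different numbers, and whichever number is smaller, one of the two neighbours can be
  improved.\<close>
lemma overlap_sum_less: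
  assumes V: "fst r \<in> V" "fst s \<in> V" "fst t \<in> V" and "s \<noteq> flip r" "t \<noteq> flip s"
  shows "length (overlap (U r) (U s)) + length (overlap (U s) (U t)) < length (U s)"
proof (rule ccontr)
  define k c where "k = overlap (U r) (U s)" "c = overlap (U s) (U t)"
  assume "\<not> ?thesis"
  moreover have le: "2 * length k \<le> length (U s)" "2 * length c \<le> length (U s)"
      "2 * length k \<le> length (U r)" "2 * length c \<le> length (U t)"
    using overlap_le_left overlap_le_right assms unfolding k_c_def by simp_all
  ultimately have len: "length k = length c" "length (U s) = 2 * length c"
    unfolding k_c_def by linarith+
  obtain r' s'' where r: "U r = r' @ winv k" and s'': "U s = k @ s''"
    using overlap_split[of "U r" "U s"] V U_reduced unfolding k_c_def by metis
  obtain s' t' where s': "U s = s' @ winv c" and t: "U t = c @ t'"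
    using overlap_split[of "U s" "U t"] V U_reduced unfolding k_c_def by metis
  have s: "U s = k @ winv c"
    using s' s'' len by (metis add_left_imp_eq append_eq_append_conv length_append mult_2
        winv_simps(5))
  have "c \<noteq> []"
    using U_nonempty V len by fastforce
  have "k \<noteq> c"
  proof
    assume "k = c"
    then have "reduce (U s) = []"
      using s reduce_cancel_left[of c "[]"] by (simp add: reduce_def[of "[]"])
    then show False
      using V U_nonempty U_reduced by simp
  qed
  have "r \<noteq> s"
  proof
    assume "r = s"
    then have "r' @ winv k = k @ winv c"
      using r s by simp
    then have "winv k = winv c"
      using len by (metis append_eq_append_conv winv_simps(5))
    with \<open>k \<noteq> c\<close> show False
      by simp
  qed
  have "t \<noteq> s"
  proof
    assume "t = s"
    then have "k @ winv c = c @ t'"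
      using t s by simp
    with \<open>k \<noteq> c\<close> len show False
      by (metis append_eq_append_conv)
  qed
  have letters: "fst ` set k \<subseteq> V" "fst ` set c \<subseteq> V"
    using U_letters[of s] U_letters[of t] V s t by auto
  have "\<not> num k < num c"
    using V s t len le same_letter[of s t] \<open>t \<noteq> s\<close> \<open>t \<noteq> flip s\<close>
    by (intro no_improving_half[of s t k c t']) auto
  moreover have "\<not> num c < num k"
  proof (rule no_improving_half[of "flip s" "flip r"])
    show "U (flip s) = c @ winv k" "U (flip r) = k @ winv r'"
      using U_flip V s r by simp_all
    show "2 * length k \<le> length (U (flip r))"
      using U_flip V le by simp
    show "fst (flip s) \<noteq> fst (flip r)"
      using same_letter[of r s] \<open>r \<noteq> s\<close> \<open>s \<noteq> flip r\<close> by auto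
  qed (use V len in simp_all)
  ultimately show False
    using num_inj len letters \<open>k \<noteq> c\<close> by (meson linorder_neqE_nat)
qed

text \<open>Each factor of the product keeps a nonempty middle part. For the induction, the statement
  records exactly which part of the first factor is left: one more factor on the left must find
  there the prefix that it is going to cancel.\<close>
lemma first_factor_survives:
  assumes "reduced (s # ws)" "fst ` set (s # ws) \<subseteq> V"
  shows "\<exists>R. reduce (concat (map U (s # ws))) =
      take (length (U s) - (if ws = [] then 0 else length (overlap (U s) (U (hd ws))))) (U s) @ R
      \<and> length R \<ge> length ws"
  using assms
proof (induction ws arbitrary: s)
  case Nil
  then show ?case
    using U_reduced by simp
next
  case (Cons t ws)
  define k where "k = overlap (U s) (U t)"
  define e where "e = (if ws = [] then 0 else length (overlap (U t) (U (hd ws))))"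
  have V: "fst s \<in> V" "fst t \<in> V" and "t \<noteq> flip s"
    using Cons.prems by (simp_all add: reduced_Cons)
  obtain R where R: "reduce (concat (map U (t # ws))) = take (length (U t) - e) (U t) @ R"
      and lR: "length R \<ge> length ws"
    using Cons.IH[of t] Cons.prems unfolding e_def by (auto simp: reduced_Cons)
  obtain s' t' where s': "U s = s' @ winv k" and t': "U t = k @ t'" and red: "reduced (s' @ t')"
    using overlap_split[of "U s" "U t"] V U_reduced unfolding k_def by metis
  have less: "length k + e < length (U t)"
  proof (cases "ws = []")
    case True
    then show ?thesis
      using overlap_le_right[OF V \<open>t \<noteq> flip s\<close>] U_nonempty[OF V(2)] unfolding k_def e_def
      by (auto simp flip: length_greater_0_conv)
  next
    case False
    then have "fst (hd ws) \<in> V" "hd ws \<noteq> flip t"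
      using Cons.prems by (auto simp: reduced_Cons)
    then show ?thesis
      using overlap_sum_less V \<open>t \<noteq> flip s\<close> False unfolding k_def e_def by simp
  qed
  define m where "m = take (length t' - e) t'"
  have pre: "take (length (U t) - e) (U t) = k @ m"
    using less t' unfolding m_def by simp
  have "m \<noteq> []"
    using less t' unfolding m_def by auto
  have "reduced (k @ m @ R)"
    using R pre by (metis append_assoc reduced_reduce)
  then have "reduced (m @ R)"
    by (simp add: reduced_append[of k])
  moreover have "hd (m @ R) = hd t'" "t' \<noteq> []"
    using \<open>m \<noteq> []\<close> unfolding m_def by (auto simp: hd_append hd_take)
  ultimately have "reduced (s' @ m @ R)"
    using red by (auto simp: reduced_append[of s'])
  have "reduce (concat (map U (s # t # ws))) = reduce (U s @ reduce (concat (map U (t # ws))))"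
    by simp
  also have "\<dots> = reduce (s' @ winv k @ k @ m @ R)"
    using R pre s' by simp
  also have "\<dots> = s' @ m @ R"
    using \<open>reduced (s' @ m @ R)\<close> by (simp add: reduce_cancel')
  finally have "reduce (concat (map U (s # t # ws))) = take (length (U s) - length k) (U s) @ m @ R"
    using s' by simp
  moreover have "length (m @ R) \<ge> length (t # ws)"
    using \<open>m \<noteq> []\<close> lR by (cases m) auto
  ultimately show ?case
    unfolding k_def by (intro exI[of _ "m @ R"]) simp
qed

lemma product_length_one:
  assumes ws: "reduced ws" "fst ` set ws \<subseteq> V" and one: "length (reduce (concat (map U ws))) = 1"
  shows "\<exists>s. ws = [s]"
proof (cases ws)
  case Nil
  with one show ?thesis
    by (simp add: reduce_def)
next
  case (Cons s vs)
  have "vs = []"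
  proof (rule ccontr)
    assume ne: "vs \<noteq> []"
    then have V: "fst s \<in> V" "fst (hd vs) \<in> V" and "hd vs \<noteq> flip s"
      using ws Cons by (auto simp: reduced_Cons)
    then have "2 * length (overlap (U s) (U (hd vs))) \<le> length (U s)"
      by (rule overlap_le_left)
    moreover have "length (U s) > 0"
      using U_nonempty V by simp
    ultimately have "length (U s) - length (overlap (U s) (U (hd vs))) \<ge> 1"
      by linarith
    moreover obtain R where "reduce (concat (map U ws)) =
        take (length (U s) - length (overlap (U s) (U (hd vs)))) (U s) @ R" "length R \<ge> length vs"
      using first_factor_survives[of s vs] ws Cons ne by auto
    ultimately show False
      using one ne by (cases vs) (auto simp: min_def split: if_splits)
  qed
  then show ?thesis
    using Cons by simp
qed

end

section \<open>Homomorphisms out of a free group\<close>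

lemma carrier_free_group: "carrier (free_group S) = {w. fst ` set w \<subseteq> S \<and> reduced w}"
  and mult_free_group [simp]: "u \<otimes>\<^bsub>free_group S\<^esub> v = reduce (u @ v)"
  and one_free_group [simp]: "\<one>\<^bsub>free_group S\<^esub> = []"
  by (simp_all add: free_group_def)

lemma in_free_group: "w \<in> carrier (free_group S) \<longleftrightarrow> fst ` set w \<subseteq> S \<and> reduced w"
  by (simp add: carrier_free_group)

lemma free_group_mult_closed:
  "u \<in> carrier (free_group S) \<Longrightarrow> v \<in> carrier (free_group S) \<Longrightarrow>
    reduce (u @ v) \<in> carrier (free_group S)"
  using letters_reduce[of "u @ v" S] by (simp add: in_free_group image_Un)

lemma reduce_winv: "reduce (w @ winv w) = []" "reduce (winv w @ w) = []"
  using reduce_cancel_left[of w "[]"] reduce_cancel_left[of "winv w" "[]"]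
  by (simp_all add: reduce_def[of "[]"])

lemma group_free_group: "group (free_group S)"
proof (rule groupI)
  fix w
  assume "w \<in> carrier (free_group S)"
  then show "\<exists>v \<in> carrier (free_group S). v \<otimes>\<^bsub>free_group S\<^esub> w = \<one>\<^bsub>free_group S\<^esub>"
    by (intro bexI[of _ "winv w"]) (simp_all add: carrier_free_group reduce_winv)
qed (simp_all add: free_group_mult_closed, simp_all add: in_free_group)

lemma inv_free_group:
  assumes "w \<in> carrier (free_group S)"
  shows "inv\<^bsub>free_group S\<^esub> w = winv w"
  by (rule group.inv_equality[OF group_free_group])
    (use assms in \<open>simp_all add: carrier_free_group reduce_winv\<close>)

lemma gen_carrier [simp]: "gen a \<in> carrier (free_group S) \<longleftrightarrow> a \<in> S"
  by (simp add: gen_def in_free_group)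

lemma free_group_mono: "S \<subseteq> T \<Longrightarrow> carrier (free_group S) \<subseteq> carrier (free_group T)"
  by (auto simp: carrier_free_group)

definition letter_value :: "('b, 'm) monoid_scheme \<Rightarrow> ('a \<Rightarrow> 'b) \<Rightarrow> 'a \<times> bool \<Rightarrow> 'b" where
  "letter_value G \<phi> s = (if snd s then \<phi> (fst s) else inv\<^bsub>G\<^esub> \<phi> (fst s))"

lemma eval_word_Nil [simp]: "eval_word G \<phi> [] = \<one>\<^bsub>G\<^esub>"
  and eval_word_Cons: "eval_word G \<phi> (s # w) = letter_value G \<phi> s \<otimes>\<^bsub>G\<^esub> eval_word G \<phi> w"
  by (simp_all add: eval_word_def letter_value_def)

lemma eval_word_cong:
  "(\<And>a. a \<in> fst ` set w \<Longrightarrow> \<phi> a = \<psi> a) \<Longrightarrow> eval_word G \<phi> w = eval_word G \<psi> w"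
  by (induction w) (auto simp: eval_word_Cons letter_value_def)

context group
begin

lemma letter_value_closed: "\<phi> (fst s) \<in> carrier G \<Longrightarrow> letter_value G \<phi> s \<in> carrier G"
  by (simp add: letter_value_def)

lemma eval_word_closed:
  "\<phi> \<in> S \<rightarrow> carrier G \<Longrightarrow> fst ` set w \<subseteq> S \<Longrightarrow> eval_word G \<phi> w \<in> carrier G"
  by (induction w) (auto simp: eval_word_Cons letter_value_closed Pi_iff)

lemma eval_word_append:
  assumes "\<phi> \<in> S \<rightarrow> carrier G" "fst ` set v \<subseteq> S"
  shows "fst ` set u \<subseteq> S \<Longrightarrow> eval_word G \<phi> (u @ v) = eval_word G \<phi> u \<otimes> eval_word G \<phi> v"
proof (induction u)
  case Nil
  then show ?case
    using eval_word_closed[OF assms] by simp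
next
  case (Cons s u)
  moreover have "letter_value G \<phi> s \<in> carrier G"
    using Cons.prems assms by (intro letter_value_closed) auto
  ultimately show ?case
    using assms eval_word_closed[of \<phi> S] by (simp add: eval_word_Cons m_assoc)
qed

text \<open>With \<open>eval_word_append\<close>, this is the universal property of the free group.\<close>
lemma eval_word_reduce:
  assumes "\<phi> \<in> S \<rightarrow> carrier G"
  shows "fst ` set w \<subseteq> S \<Longrightarrow> eval_word G \<phi> (reduce w) = eval_word G \<phi> w"
proof (induction w)
  case Nil
  then show ?case
    by (simp add: reduce_def)
next
  case (Cons s w)
  let ?r = "reduce w"
  have r: "fst ` set ?r \<subseteq> S"
    using Cons.prems by (intro letters_reduce) auto
  have s: "\<phi> (fst s) \<in> carrier G"
    using Cons.prems assms by auto
  have "eval_word G \<phi> (push s ?r) = letter_value G \<phi> s \<otimes> eval_word G \<phi> ?r"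
  proof (cases "?r \<noteq> [] \<and> hd ?r = flip s")
    case True
    then obtain v where v: "?r = flip s # v"
      by (cases ?r) auto
    have "letter_value G \<phi> s \<otimes> letter_value G \<phi> (flip s) = \<one>"
      using s by (simp add: letter_value_def flip_def)
    then have "letter_value G \<phi> s \<otimes> (letter_value G \<phi> (flip s) \<otimes> eval_word G \<phi> v) = eval_word G \<phi> v"
      using s r v eval_word_closed[OF assms, of v] letter_value_closed[of \<phi> s]
        letter_value_closed[of \<phi> "flip s"] by (simp flip: m_assoc)
    then show ?thesis
      using v by (simp add: eval_word_Cons cancels_iff)
  next
    case False
    then have "push s ?r = s # ?r"
      by (simp only: push_eq if_False)
    then show ?thesis
      by (simp add: eval_word_Cons)
  qed
  with Cons show ?case
    by (simp add: reduce_Cons eval_word_Cons)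
qed

lemma eval_word_hom:
  assumes "\<phi> \<in> S \<rightarrow> carrier G"
  shows "eval_word G \<phi> \<in> hom (free_group S) G"
proof (rule homI)
  fix u v
  assume "u \<in> carrier (free_group S)" "v \<in> carrier (free_group S)"
  then show "eval_word G \<phi> (u \<otimes>\<^bsub>free_group S\<^esub> v) = eval_word G \<phi> u \<otimes> eval_word G \<phi> v"
    using eval_word_append[OF assms] eval_word_reduce[OF assms, of "u @ v"]
    by (simp add: in_free_group image_Un)
qed (use eval_word_closed[OF assms] in \<open>simp add: in_free_group\<close>)

lemma eval_word_gen: "\<phi> a \<in> carrier G \<Longrightarrow> eval_word G \<phi> (gen a) = \<phi> a"
  by (simp add: gen_def eval_word_Cons letter_value_def)

lemma hom_eq_eval_word:
  assumes f: "f \<in> hom (free_group S) G" and w: "w \<in> carrier (free_group S)"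
  shows "f w = eval_word G (\<lambda>a. f (gen a)) w"
proof -
  interpret f: group_hom "free_group S" G f
    using f group_free_group by (simp add: group_hom_def group_hom_axioms_def)
  have letter: "f [s] = letter_value G (\<lambda>a. f (gen a)) s" if "fst s \<in> S" for s
  proof -
    have "winv (gen (fst s)) = [(fst s, False)]"
      by (simp add: gen_def flip_def)
    then have "f [(fst s, False)] = inv (f (gen (fst s)))"
      using that f.hom_inv[of "gen (fst s)"] inv_free_group[of "gen (fst s)" S] by simp
    then show ?thesis
      by (cases s) (auto simp: letter_value_def gen_def)
  qed
  show ?thesis
    using w
  proof (induction w)
    case Nil
    then show ?case
      using f.hom_one by simp
  next
    case (Cons s w)
    then have "f (s # w) = f [s] \<otimes> f w"
      using f.hom_mult[of "[s]" w] by (simp add: in_free_group reduced_Cons)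
    then show ?case
      using Cons letter by (simp add: eval_word_Cons in_free_group reduced_Cons)
  qed
qed

end

lemma hom_free_group_ext:
  assumes "f \<in> hom (free_group V) G" "g \<in> hom (free_group V) G" "group G" "S \<subseteq> V"
    and "\<And>a. a \<in> S \<Longrightarrow> f (gen a) = g (gen a)" and w: "w \<in> carrier (free_group S)"
  shows "f w = g w"
proof -
  have "w \<in> carrier (free_group V)"
    using w assms(4) free_group_mono by blast
  moreover have "eval_word G (\<lambda>a. f (gen a)) w = eval_word G (\<lambda>a. g (gen a)) w"
    using assms by (intro eval_word_cong) (auto simp: in_free_group)
  ultimately show ?thesis
    using assms group.hom_eq_eval_word by metis
qed

lemma free_group_subgroup:
  assumes "S \<subseteq> V"
  shows "subgroup (carrier (free_group S)) (free_group V)"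
proof -
  interpret F: group "free_group V"
    by (rule group_free_group)
  show ?thesis
  proof (rule F.subgroupI)
    fix w
    assume w: "w \<in> carrier (free_group S)"
    then have "w \<in> carrier (free_group V)"
      using assms free_group_mono by blast
    then show "inv\<^bsub>free_group V\<^esub> w \<in> carrier (free_group S)"
      using w by (simp add: inv_free_group) (simp add: in_free_group)
  next
    show "carrier (free_group S) \<noteq> {}"
      using group.is_monoid[OF group_free_group] monoid.one_closed by blast
  qed (use assms free_group_mono free_group_mult_closed in auto)
qed

lemma subgroup_of_free_group_contains:
  assumes "subgroup K (free_group V)" "S \<subseteq> V" "\<And>a. a \<in> S \<Longrightarrow> gen a \<in> K"
  shows "carrier (free_group S) \<subseteq> K"
proof
  interpret K: subgroup K "free_group V"
    by fact
  fix w
  assume "w \<in> carrier (free_group S)"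
  then show "w \<in> K"
  proof (induction w)
    case Nil
    then show ?case
      using K.one_closed by simp
  next
    case (Cons s w)
    then have a: "fst s \<in> S" and w: "w \<in> K"
      by (auto simp: in_free_group reduced_Cons)
    have "gen (fst s) \<in> carrier (free_group V)"
      using a assms(2) by auto
    then have "inv\<^bsub>free_group V\<^esub> gen (fst s) = [(fst s, False)]"
      by (simp only: inv_free_group) (simp add: gen_def flip_def)
    then have "[(fst s, False)] \<in> K"
      using K.m_inv_closed assms(3) a by metis
    then have "[s] \<in> K"
      using assms(3)[OF a] by (cases s; cases "snd s") (auto simp: gen_def)
    then have "reduce ([s] @ w) \<in> K"
      using K.m_closed w by (metis mult_free_group)
    then show ?case
      using Cons.prems by (simp add: in_free_group)
  qed
qed

section \<open>Automorphisms of a free group\<close>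

lemma AutoGroup_simps:
  "carrier (AutoGroup G) = auto G"
  "\<one>\<^bsub>AutoGroup G\<^esub> = (\<lambda>x \<in> carrier G. x)"
  "f \<in> auto G \<Longrightarrow> g \<in> auto G \<Longrightarrow> f \<otimes>\<^bsub>AutoGroup G\<^esub> g = compose (carrier G) f g"
  by (simp_all add: AutoGroup_def BijGroup_def auto_def)

lemma autoD:
  assumes "f \<in> auto G"
  shows "f \<in> hom G G" "bij_betw f (carrier G) (carrier G)" "f \<in> extensional (carrier G)"
    "\<And>x. x \<in> carrier G \<Longrightarrow> f x \<in> carrier G"
  using assms by (auto simp: auto_def Bij_def bij_betw_def)

lemma auto_mult:
  "f \<in> auto G \<Longrightarrow> g \<in> auto G \<Longrightarrow> x \<in> carrier G \<Longrightarrow> (f \<otimes>\<^bsub>AutoGroup G\<^esub> g) x = f (g x)"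
  by (simp add: AutoGroup_simps compose_def)

locale free_group_on =
  fixes V :: "'a set"
begin

abbreviation F :: "'a word monoid" where "F \<equiv> free_group V"
abbreviation Aut :: "('a word \<Rightarrow> 'a word) monoid" where "Aut \<equiv> AutoGroup F"
abbreviation word_mult (infixl "\<cdot>" 70) where "u \<cdot> v \<equiv> u \<otimes>\<^bsub>F\<^esub> v"
abbreviation word_inv ("\<iota> _" [81] 80) where "\<iota> u \<equiv> inv\<^bsub>F\<^esub> u"

sublocale F: group F
  by (rule group_free_group)

sublocale Aut: group Aut
  by (rule F.AutoGroup)

text \<open>From here on, products in \<open>F\<close> are kept in the language of groups rather than unfolded to
  words.\<close>
lemmas mult_free_group [simp del] one_free_group [simp del]

lemma inv_mult_cancel [simp]:
  "u \<in> carrier F \<Longrightarrow> v \<in> carrier F \<Longrightarrow> u \<cdot> (\<iota> u \<cdot> v) = v"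
  "u \<in> carrier F \<Longrightarrow> v \<in> carrier F \<Longrightarrow> \<iota> u \<cdot> (u \<cdot> v) = v"
  by (simp_all flip: F.m_assoc)

lemma auto_hom:
  assumes "f \<in> auto F"
  shows "u \<in> carrier F \<Longrightarrow> v \<in> carrier F \<Longrightarrow> f (u \<cdot> v) = f u \<cdot> f v"
    "u \<in> carrier F \<Longrightarrow> f (\<iota> u) = \<iota> (f u)" "f \<one>\<^bsub>F\<^esub> = \<one>\<^bsub>F\<^esub>"
    "u \<in> carrier F \<Longrightarrow> f u \<in> carrier F"
proof -
  interpret f: group_hom F F f
    using autoD[OF assms] by unfold_locales
  show "u \<in> carrier F \<Longrightarrow> v \<in> carrier F \<Longrightarrow> f (u \<cdot> v) = f u \<cdot> f v"
    "u \<in> carrier F \<Longrightarrow> f (\<iota> u) = \<iota> (f u)" "f \<one>\<^bsub>F\<^esub> = \<one>\<^bsub>F\<^esub>"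
    "u \<in> carrier F \<Longrightarrow> f u \<in> carrier F"
    by simp_all
qed

lemma auto_ext:
  assumes "f \<in> auto F" "g \<in> auto F" "\<And>a. a \<in> V \<Longrightarrow> f (gen a) = g (gen a)"
  shows "f = g"
proof (rule extensionalityI)
  fix w
  assume "w \<in> carrier F"
  then show "f w = g w"
    using hom_free_group_ext[OF autoD(1)[OF assms(1)] autoD(1)[OF assms(2)] F.is_group subset_refl]
      assms(3) by blast
qed (use autoD(3)[OF assms(1)] autoD(3)[OF assms(2)] in simp_all)

lemma Aut_closed:
  "f \<in> auto F \<Longrightarrow> g \<in> auto F \<Longrightarrow> f \<otimes>\<^bsub>Aut\<^esub> g \<in> auto F"
  "f \<in> auto F \<Longrightarrow> inv\<^bsub>Aut\<^esub> f \<in> auto F"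
  using Aut.m_closed Aut.inv_closed by (simp_all add: AutoGroup_simps(1))

lemma inverse_apply:
  assumes f: "f \<in> auto F" and w: "w \<in> carrier F"
  shows "(inv\<^bsub>Aut\<^esub> f) (f w) = w" "f ((inv\<^bsub>Aut\<^esub> f) w) = w"
proof -
  have "(inv\<^bsub>Aut\<^esub> f \<otimes>\<^bsub>Aut\<^esub> f) w = w" "(f \<otimes>\<^bsub>Aut\<^esub> inv\<^bsub>Aut\<^esub> f) w = w"
    using f w Aut.l_inv[of f] Aut.r_inv[of f] by (simp_all add: AutoGroup_simps(1,2))
  then show "(inv\<^bsub>Aut\<^esub> f) (f w) = w" "f ((inv\<^bsub>Aut\<^esub> f) w) = w"
    using f w Aut_closed(2)[OF f] by (simp_all add: auto_mult)
qed

text \<open>Conjugates are computed on letters. Writing the claim as \<open>g s = t g\<close> avoids any computation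
  with the inverse of \<open>g\<close>.\<close>
lemma conjugate_eqI:
  assumes "g \<in> auto F" "s \<in> auto F" "t \<in> auto F"
    and "\<And>a. a \<in> V \<Longrightarrow> g (s (gen a)) = t (g (gen a))"
  shows "g \<otimes>\<^bsub>Aut\<^esub> s \<otimes>\<^bsub>Aut\<^esub> inv\<^bsub>Aut\<^esub> g = t"
proof -
  have closed: "g \<in> carrier Aut" "s \<in> carrier Aut" "t \<in> carrier Aut"
    using assms by (simp_all add: AutoGroup_simps)
  have "g \<otimes>\<^bsub>Aut\<^esub> s = t \<otimes>\<^bsub>Aut\<^esub> g"
  proof (rule auto_ext)
    show "g \<otimes>\<^bsub>Aut\<^esub> s \<in> auto F" "t \<otimes>\<^bsub>Aut\<^esub> g \<in> auto F"
      using assms by (simp_all add: Aut_closed)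
  qed (use assms in \<open>simp add: auto_mult\<close>)
  then show ?thesis
    using closed by (simp add: Aut.m_assoc)
qed

abbreviation avoiding :: "'a \<Rightarrow> 'a word set" where
  "avoiding b \<equiv> carrier (free_group (V - {b}))"

lemma avoiding_closed:
  "u \<in> avoiding b \<Longrightarrow> v \<in> avoiding b \<Longrightarrow> u \<cdot> v \<in> avoiding b"
  "u \<in> avoiding b \<Longrightarrow> \<iota> u \<in> avoiding b"
  "\<one>\<^bsub>F\<^esub> \<in> avoiding b"
  "u \<in> avoiding b \<Longrightarrow> u \<in> carrier F"
proof -
  interpret A: subgroup "avoiding b" F
    by (rule free_group_subgroup) simp
  show "u \<in> avoiding b \<Longrightarrow> v \<in> avoiding b \<Longrightarrow> u \<cdot> v \<in> avoiding b"
    "u \<in> avoiding b \<Longrightarrow> \<iota> u \<in> avoiding b"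
    "\<one>\<^bsub>F\<^esub> \<in> avoiding b"
    "u \<in> avoiding b \<Longrightarrow> u \<in> carrier F"
    by simp_all
qed

text \<open>The generators, and the automorphisms by which they get multiplied or conjugated below, all
  change a single letter and have the form \<open>b \<mapsto> u b u'\<close>. This is an automorphism when \<open>u\<close> and \<open>u'\<close>
  do not involve \<open>b\<close>; the inverse then is \<open>b \<mapsto> \<iota> u b \<iota> u'\<close>.\<close>
definition transv :: "'a \<Rightarrow> 'a word \<Rightarrow> 'a word \<Rightarrow> 'a word \<Rightarrow> 'a word" where
  "transv b u u' = endo V (gen(b := u \<cdot> gen b \<cdot> u'))"

context
  fixes b u u'
  assumes b: "b \<in> V" and u: "u \<in> avoiding b" "u' \<in> avoiding b"
begin

lemma transv_words_in_F: "u \<in> carrier F" "u' \<in> carrier F"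
  using u by (simp_all add: avoiding_closed(4)[of _ b])

lemma transv_hom: "transv b u u' \<in> hom F F"
proof -
  have "eval_word F (gen(b := u \<cdot> gen b \<cdot> u')) \<in> hom F F"
    using b transv_words_in_F by (intro F.eval_word_hom) simp
  then show ?thesis
    unfolding transv_def endo_def by (simp add: hom_def Pi_iff)
qed

lemma transv_gen: "a \<in> V \<Longrightarrow> transv b u u' (gen a) = (if a = b then u \<cdot> gen b \<cdot> u' else gen a)"
  using b transv_words_in_F unfolding transv_def endo_def by (simp add: F.eval_word_gen)

lemma transv_avoiding:
  assumes "w \<in> avoiding b"
  shows "transv b u u' w = w"
proof (rule hom_free_group_ext[OF transv_hom _ F.is_group _ _ assms])
  show "(\<lambda>w. w) \<in> hom F F"
    by (simp add: hom_def)
qed (simp_all add: transv_gen)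

end

lemmas avoiding_closed(1-3) [simp]

lemma transv_transv:
  assumes b: "b \<in> V" and u: "u \<in> avoiding b" "u' \<in> avoiding b"
    and v: "v \<in> avoiding b" "v' \<in> avoiding b" and w: "w \<in> carrier F"
  shows "transv b u u' (transv b v v' w) = transv b (v \<cdot> u) (u' \<cdot> v') w"
proof -
  interpret T: group_hom F F "transv b u u'"
    using b u transv_hom by unfold_locales
  have vF: "v \<in> carrier F" "v' \<in> carrier F" "u \<in> carrier F" "u' \<in> carrier F"
    using u v by (simp_all add: avoiding_closed(4)[of _ b])
  have "(transv b u u' \<circ> transv b v v') w = transv b (v \<cdot> u) (u' \<cdot> v') w"
  proof (rule hom_free_group_ext[OF _ _ F.is_group subset_refl _ w])
    show "transv b u u' \<circ> transv b v v' \<in> hom F F"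
      using b u v transv_hom hom_compose by blast
    show "transv b (v \<cdot> u) (u' \<cdot> v') \<in> hom F F"
      using b u v by (simp add: transv_hom)
    show "(transv b u u' \<circ> transv b v v') (gen a) = transv b (v \<cdot> u) (u' \<cdot> v') (gen a)"
      if "a \<in> V" for a
      using b u v vF that by (simp add: transv_gen transv_avoiding F.m_assoc)
  qed
  then show ?thesis
    by simp
qed

lemma transv_one:
  assumes "b \<in> V"
  shows "transv b \<one>\<^bsub>F\<^esub> \<one>\<^bsub>F\<^esub> = (\<lambda>x \<in> carrier F. x)"
proof (rule extensionalityI)
  show "transv b \<one>\<^bsub>F\<^esub> \<one>\<^bsub>F\<^esub> \<in> extensional (carrier F)"
    by (simp add: transv_def endo_def)
  fix w
  assume w: "w \<in> carrier F"
  have "transv b \<one>\<^bsub>F\<^esub> \<one>\<^bsub>F\<^esub> w = w"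
  proof (rule hom_free_group_ext[OF _ _ F.is_group subset_refl _ w])
    show "(\<lambda>w. w) \<in> hom F F"
      by (simp add: hom_def)
  qed (use assms in \<open>simp_all add: transv_hom transv_gen\<close>)
  with w show "transv b \<one>\<^bsub>F\<^esub> \<one>\<^bsub>F\<^esub> w = (\<lambda>x \<in> carrier F. x) w"
    by simp
qed simp

lemma transv_auto:
  assumes b: "b \<in> V" and u: "u \<in> avoiding b" "u' \<in> avoiding b"
  shows "transv b u u' \<in> auto F"
proof -
  have uF: "u \<in> carrier F" "u' \<in> carrier F"
    using u by (simp_all add: avoiding_closed(4)[of _ b])
  have "bij_betw (transv b u u') (carrier F) (carrier F)"
  proof (rule bij_betw_byWitness[of _ "transv b (\<iota> u) (\<iota> u')"])
    show "transv b u u' ` carrier F \<subseteq> carrier F" "transv b (\<iota> u) (\<iota> u') ` carrier F \<subseteq> carrier F"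
      using b u transv_hom[of b u u'] transv_hom[of b "\<iota> u" "\<iota> u'"] by (auto simp: hom_def)
  qed (use b u uF in \<open>simp_all add: transv_transv transv_one\<close>)
  moreover have "transv b u u' \<in> extensional (carrier F)"
    by (simp add: transv_def endo_def)
  ultimately show ?thesis
    using b u by (simp add: auto_def Bij_def transv_hom)
qed

lemma transv_mult:
  assumes "b \<in> V" "u \<in> avoiding b" "u' \<in> avoiding b" "v \<in> avoiding b" "v' \<in> avoiding b"
  shows "transv b u u' \<otimes>\<^bsub>Aut\<^esub> transv b v v' = transv b (v \<cdot> u) (u' \<cdot> v')"
  by (rule auto_ext) (use assms in \<open>simp_all add: Aut_closed transv_auto auto_mult transv_transv\<close>)

lemma transv_inv:
  assumes "b \<in> V" "u \<in> avoiding b" "u' \<in> avoiding b"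
  shows "inv\<^bsub>Aut\<^esub> transv b u u' = transv b (\<iota> u) (\<iota> u')"
proof (rule Aut.inv_equality)
  have "u \<in> carrier F" "u' \<in> carrier F"
    using assms by (simp_all add: avoiding_closed(4)[of _ b])
  then show "transv b (\<iota> u) (\<iota> u') \<otimes>\<^bsub>Aut\<^esub> transv b u u' = \<one>\<^bsub>Aut\<^esub>"
    using assms by (simp add: transv_mult transv_one AutoGroup_simps)
qed (use assms in \<open>simp_all add: AutoGroup_simps transv_auto\<close>)

text \<open>For a letter \<open>n\<close>, the flags select the automorphisms of the statement: left only is \<open>M\<close> with
  sign \<open>1\<close>, right only is \<open>M\<close> with sign \<open>-1\<close>, both is \<open>C\<close>. For fixed flags and \<open>b\<close> the map is an
  antihomomorphism in \<open>n\<close>, and this is what \<open>side_transv_subgroup\<close> uses: to get all \<open>n\<close> of a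
  subgroup into \<open>H\<close>, only generators of that subgroup have to be checked.\<close>

definition side_transv :: "bool \<Rightarrow> bool \<Rightarrow> 'a \<Rightarrow> 'a word \<Rightarrow> 'a word \<Rightarrow> 'a word" where
  "side_transv l r b n = transv b (if l then n else \<one>\<^bsub>F\<^esub>) (if r then \<iota> n else \<one>\<^bsub>F\<^esub>)"

lemma side_transv_auto: "b \<in> V \<Longrightarrow> n \<in> avoiding b \<Longrightarrow> side_transv l r b n \<in> auto F"
  by (simp add: side_transv_def transv_auto)

lemma side_transv_subgroup:
  assumes b: "b \<in> V" and H: "subgroup H Aut"
  shows "subgroup {n \<in> avoiding b. side_transv l r b n \<in> H} F"
proof -
  interpret H: subgroup H Aut
    by fact
  have mult: "side_transv l r b m \<otimes>\<^bsub>Aut\<^esub> side_transv l r b n = side_transv l r b (n \<cdot> m)"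
    if "m \<in> avoiding b" "n \<in> avoiding b" for m n
    using that b by (simp add: side_transv_def transv_mult F.inv_mult_group avoiding_closed(4)[of _
        b])
  have inverse: "inv\<^bsub>Aut\<^esub> side_transv l r b n = side_transv l r b (\<iota> n)" if "n \<in> avoiding b" for n
    using that b by (simp add: side_transv_def transv_inv)
  show ?thesis
  proof (rule F.subgroupI)
    have "side_transv l r b \<one>\<^bsub>F\<^esub> = \<one>\<^bsub>Aut\<^esub>"
      using b transv_one by (simp add: side_transv_def AutoGroup_simps)
    then have "\<one>\<^bsub>F\<^esub> \<in> {n \<in> avoiding b. side_transv l r b n \<in> H}"
      by simp
    then show "{n \<in> avoiding b. side_transv l r b n \<in> H} \<noteq> {}"
      by blast
    show "{n \<in> avoiding b. side_transv l r b n \<in> H} \<subseteq> carrier F"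
      using avoiding_closed(4) by blast
  next
    fix n
    assume "n \<in> {n \<in> avoiding b. side_transv l r b n \<in> H}"
    then show "\<iota> n \<in> {n \<in> avoiding b. side_transv l r b n \<in> H}"
      by (simp flip: inverse)
  next
    fix n m
    assume "n \<in> {n \<in> avoiding b. side_transv l r b n \<in> H}" "m \<in> {n \<in> avoiding b. side_transv l r b n
        \<in> H}"
    then show "n \<cdot> m \<in> {n \<in> avoiding b. side_transv l r b n \<in> H}"
      by (simp flip: mult)
  qed
qed

lemma subgroup_conjugate_in:
  assumes H: "subgroup H Aut" and "g \<in> H" "s \<in> H" and t: "t \<in> auto F"
    and "\<And>a. a \<in> V \<Longrightarrow> g (s (gen a)) = t (g (gen a))"
  shows "t \<in> H"
proof -
  interpret H: subgroup H Aut
    by fact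
  have "g \<in> auto F" "s \<in> auto F"
    using assms H.subset by (auto simp: AutoGroup_simps)
  then have "g \<otimes>\<^bsub>Aut\<^esub> s \<otimes>\<^bsub>Aut\<^esub> inv\<^bsub>Aut\<^esub> g = t"
    using assms by (intro conjugate_eqI)
  then show ?thesis
    using assms H.m_closed H.m_inv_closed by metis
qed

end

section \<open>The subgroup generated by the moves along \<open>Y\<close>\<close>

locale peripheral_letters = free_group_on V
  for V :: "'a set" +
  fixes X Y Z :: "'a set"
  assumes V_eq: "V = X \<union> Y \<union> Z"
    and disjoint: "X \<inter> Y = {}" "X \<inter> Z = {}" "Y \<inter> Z = {}"
begin

lemma V_iff: "a \<in> V \<longleftrightarrow> a \<in> X \<or> a \<in> Y \<or> a \<in> Z"
  by (auto simp: V_eq)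

abbreviation complement_words :: "'a \<Rightarrow> 'a word set" where
  "complement_words b \<equiv> carrier (free_group (X \<union> Z - {b}))"

text \<open>For \<open>b\<close> outside \<open>Y\<close>, this is the set of those elements of the normal closure of \<open>Y\<close> that do
  not involve \<open>b\<close>: the multipliers \<open>n\<close> for which \<open>b \<mapsto> n b\<close> is an automorphism that is trivial
  modulo \<open>Y\<close>.\<close>
definition kernel_part :: "'a \<Rightarrow> 'a word set" where
  "kernel_part b = generate F {w \<cdot> gen y \<cdot> \<iota> w | w y. y \<in> Y \<and> w \<in> complement_words b}"

lemma complement_closed:
  "w \<in> complement_words b \<Longrightarrow> b \<notin> Y \<Longrightarrow> w \<in> avoiding b"
  "w \<in> complement_words b \<Longrightarrow> w \<in> carrier F"
  "w \<in> complement_words b \<Longrightarrow> y \<in> Y \<Longrightarrow> w \<in> avoiding y"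
  using free_group_mono[of "X \<union> Z - {b}" "V - {b}"] free_group_mono[of "X \<union> Z - {b}" V]
    free_group_mono[of "X \<union> Z - {b}" "V - {y}"] disjoint V_iff by blast+

lemma complement_subgroup: "subgroup (complement_words b) F"
  by (rule free_group_subgroup) (auto simp: V_iff)

lemma kernel_part_subgroup: "subgroup (kernel_part b) F"
  unfolding kernel_part_def
  by (rule F.generate_is_subgroup) (auto simp: complement_closed V_iff)

lemma kernel_part_closed:
  "n \<in> kernel_part b \<Longrightarrow> m \<in> kernel_part b \<Longrightarrow> n \<cdot> m \<in> kernel_part b"
  "n \<in> kernel_part b \<Longrightarrow> \<iota> n \<in> kernel_part b"
  "\<one>\<^bsub>F\<^esub> \<in> kernel_part b"
  "n \<in> kernel_part b \<Longrightarrow> n \<in> carrier F"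
  using subgroup.m_closed[OF kernel_part_subgroup] subgroup.m_inv_closed[OF kernel_part_subgroup]
    subgroup.one_closed[OF kernel_part_subgroup] subgroup.mem_carrier[OF kernel_part_subgroup]
  by blast+

lemma gen_in_kernel_part: "y \<in> Y \<Longrightarrow> gen y \<in> kernel_part b"
proof -
  assume y: "y \<in> Y"
  have "gen y = \<one>\<^bsub>F\<^esub> \<cdot> gen y \<cdot> \<iota> \<one>\<^bsub>F\<^esub>"
    using y by (simp add: V_iff)
  then show ?thesis
    unfolding kernel_part_def using y subgroup.one_closed[OF complement_subgroup]
    by (intro generate.incl) blast
qed

lemma kernel_part_minimal:
  assumes "subgroup K F" "\<And>w y. y \<in> Y \<Longrightarrow> w \<in> complement_words b \<Longrightarrow> w \<cdot> gen y \<cdot> \<iota> w \<in> K"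
  shows "kernel_part b \<subseteq> K"
  unfolding kernel_part_def by (rule F.generate_subgroup_incl) (use assms in auto)

lemma kernel_part_avoiding: "b \<notin> Y \<Longrightarrow> kernel_part b \<subseteq> avoiding b"
proof (rule kernel_part_minimal)
  fix w y
  assume "b \<notin> Y" "y \<in> Y" "w \<in> complement_words b"
  moreover from this have "gen y \<in> avoiding b"
    by (auto simp: V_iff)
  ultimately show "w \<cdot> gen y \<cdot> \<iota> w \<in> avoiding b"
    using complement_closed by simp
qed (rule free_group_subgroup, auto)

lemma kernel_part_conjugate:
  assumes u: "u \<in> complement_words b" and n: "n \<in> kernel_part b"
  shows "u \<cdot> n \<cdot> \<iota> u \<in> kernel_part b"
proof -
  have uF: "u \<in> carrier F"
    using u complement_closed by blast
  let ?K = "{n \<in> carrier F. u \<cdot> n \<cdot> \<iota> u \<in> kernel_part b}"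
  have "kernel_part b \<subseteq> ?K"
  proof (rule kernel_part_minimal)
    show "subgroup ?K F"
    proof (rule F.subgroupI)
      have "\<one>\<^bsub>F\<^esub> \<in> ?K"
        using uF kernel_part_closed by simp
      then show "?K \<noteq> {}"
        by blast
    next
      fix n
      assume n: "n \<in> ?K"
      have "u \<cdot> \<iota> n \<cdot> \<iota> u = \<iota> (u \<cdot> n \<cdot> \<iota> u)"
        using uF n by (simp add: F.inv_mult_group F.m_assoc)
      then show "\<iota> n \<in> ?K"
        using n kernel_part_closed by simp
    next
      fix n m
      assume nm: "n \<in> ?K" "m \<in> ?K"
      have "u \<cdot> (n \<cdot> m) \<cdot> \<iota> u = (u \<cdot> n \<cdot> \<iota> u) \<cdot> (u \<cdot> m \<cdot> \<iota> u)"
        using uF nm by (simp add: F.m_assoc)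
      then show "n \<cdot> m \<in> ?K"
        using nm kernel_part_closed by simp
    qed auto
    fix w y
    assume y: "y \<in> Y" and w: "w \<in> complement_words b"
    have wF: "w \<in> carrier F" "gen y \<in> carrier F"
      using w y complement_closed by (auto simp: V_iff)
    have "u \<cdot> (w \<cdot> gen y \<cdot> \<iota> w) \<cdot> \<iota> u = (u \<cdot> w) \<cdot> gen y \<cdot> \<iota> (u \<cdot> w)"
      using uF wF by (simp add: F.inv_mult_group F.m_assoc)
    moreover have "u \<cdot> w \<in> complement_words b"
      using u w subgroup.m_closed[OF complement_subgroup] by blast
    ultimately have "u \<cdot> (w \<cdot> gen y \<cdot> \<iota> w) \<cdot> \<iota> u \<in> kernel_part b"
      unfolding kernel_part_def using y by (intro generate.incl) auto
    then show "w \<cdot> gen y \<cdot> \<iota> w \<in> ?K"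
      using wF by simp
  qed
  with n show ?thesis
    by blast
qed

text \<open>The automorphism \<open>a \<mapsto> n a n'\<close> is trivial modulo \<open>Y\<close>, and since neither \<open>u\<close> nor its image
  involves \<open>b\<close>, the quotient of the two is found in \<open>kernel_part b\<close>. It is a cocycle in \<open>u\<close>, so by
  \<open>kernel_part_conjugate\<close> it is enough to look at letters \<open>u\<close>.\<close>
lemma displacement_in_kernel_part:
  assumes a: "a \<in> X \<union> Z" "a \<noteq> b" and n: "n \<in> carrier (free_group Y)" "n' \<in> carrier (free_group Y)"
    and u: "u \<in> complement_words b"
  shows "\<iota> (transv a n n' u) \<cdot> u \<in> kernel_part b"
proof -
  let ?s = "transv a n n'"
  have "carrier (free_group Y) \<subseteq> kernel_part b"
    by (rule subgroup_of_free_group_contains[OF kernel_part_subgroup])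
      (auto simp: gen_in_kernel_part V_iff)
  then have nK: "n \<in> kernel_part b" "n' \<in> kernel_part b"
    using n by auto
  then have nF: "n \<in> carrier F" "n' \<in> carrier F"
    using kernel_part_closed by auto
  have "carrier (free_group Y) \<subseteq> avoiding a"
    using a disjoint by (intro free_group_mono) (auto simp: V_iff)
  then have na: "n \<in> avoiding a" "n' \<in> avoiding a"
    using n by auto
  have aV: "a \<in> V"
    using a by (auto simp: V_iff)
  have s: "?s \<in> auto F"
    using aV na by (rule transv_auto)
  have sgen: "?s (gen c) = (if c = a then n \<cdot> gen a \<cdot> n' else gen c)" if "c \<in> V" for c
    using aV na that by (rule transv_gen)
  let ?K = "{u \<in> complement_words b. \<iota> (?s u) \<cdot> u \<in> kernel_part b}"
  have "complement_words b \<subseteq> ?K"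
  proof (rule subgroup_of_free_group_contains)
    show "subgroup ?K F"
    proof (rule F.subgroupI)
      show "?K \<subseteq> carrier F"
        using complement_closed by blast
      have "\<one>\<^bsub>F\<^esub> \<in> ?K"
        using subgroup.one_closed[OF complement_subgroup] auto_hom(3)[OF s] kernel_part_closed by simp
      then show "?K \<noteq> {}"
        by blast
    next
      fix u
      assume u: "u \<in> ?K"
      then have uF: "u \<in> carrier F" "?s u \<in> carrier F"
        using complement_closed auto_hom[OF s] by auto
      have "\<iota> (?s (\<iota> u)) \<cdot> \<iota> u = u \<cdot> \<iota> (\<iota> (?s u) \<cdot> u) \<cdot> \<iota> u"
        using uF by (simp add: auto_hom[OF s] F.inv_mult_group F.m_assoc)
      then show "\<iota> u \<in> ?K"
        using u kernel_part_conjugate kernel_part_closed subgroup.m_inv_closed[OF complement_subgroup]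
        by simp
    next
      fix u v
      assume uv: "u \<in> ?K" "v \<in> ?K"
      then have F: "u \<in> carrier F" "?s u \<in> carrier F" "v \<in> carrier F" "?s v \<in> carrier F"
        using complement_closed auto_hom[OF s] by auto
      have "\<iota> (?s (u \<cdot> v)) \<cdot> (u \<cdot> v) = (\<iota> (?s v) \<cdot> v) \<cdot> (\<iota> v \<cdot> (\<iota> (?s u) \<cdot> u) \<cdot> \<iota> (\<iota> v))"
        using F by (simp add: auto_hom[OF s] F.inv_mult_group F.m_assoc)
      moreover have "\<iota> v \<in> complement_words b"
        using uv subgroup.m_inv_closed[OF complement_subgroup] by simp
      ultimately show "u \<cdot> v \<in> ?K"
        using uv kernel_part_conjugate kernel_part_closed subgroup.m_closed[OF complement_subgroup]
        by simp
    qed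
    fix c
    assume c: "c \<in> X \<union> Z - {b}"
    then have cF: "gen c \<in> carrier F"
      by (auto simp: V_iff)
    show "gen c \<in> ?K"
    proof (cases "c = a")
      case True
      have "\<iota> (?s (gen c)) \<cdot> gen c = \<iota> n' \<cdot> (\<iota> (gen c) \<cdot> \<iota> n \<cdot> \<iota> (\<iota> (gen c)))"
        using sgen[of c] c True nF cF by (auto simp: V_iff F.inv_mult_group F.m_assoc)
      moreover have "\<iota> (gen c) \<in> complement_words b"
        using c subgroup.m_inv_closed[OF complement_subgroup] by simp
      ultimately show ?thesis
        using c nK kernel_part_closed kernel_part_conjugate by simp
    next
      case False
      then show ?thesis
        using c cF sgen[of c] kernel_part_closed by (auto simp: V_iff)
    qed
  qed (auto simp: V_iff)
  with u show ?thesis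
    by blast
qed

definition kernel_moves :: "('a word \<Rightarrow> 'a word) set" where
  "kernel_moves =
     {M_aut V x \<epsilon> y | x y \<epsilon>. x \<in> X \<and> y \<in> Y \<and> \<epsilon> \<in> {1, -1}}
     \<union> {C_aut V z y | z y. z \<in> Z \<and> y \<in> Y}
     \<union> {C_aut V y v | y v. y \<in> Y \<and> v \<in> V \<and> y \<noteq> v}"

definition move_group :: "('a word \<Rightarrow> 'a word) set" where
  "move_group = generate Aut kernel_moves"

lemma C_aut_eq: "v \<in> V \<Longrightarrow> C_aut V w v = side_transv True True w (gen v)"
  by (simp add: C_aut_def side_transv_def transv_def)

lemma M_aut_eq:
  assumes "x \<in> V" "y \<in> V"
  shows "M_aut V x 1 y = side_transv True False x (gen y)"
    "M_aut V x (-1) y = side_transv False True x (gen y)"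
  using assms by (simp_all add: M_aut_def side_transv_def transv_def)

lemma kernel_moves_cases:
  assumes "s \<in> kernel_moves"
  obtains (Y) a v where "a \<in> Y" "v \<in> V" "v \<noteq> a" "s = side_transv True True a (gen v)"
  | (XZ) a y l r where "a \<in> X \<and> l \<noteq> r \<or> a \<in> Z \<and> l \<and> r" "y \<in> Y" "s = side_transv l r a (gen y)"
  using assms unfolding kernel_moves_def
proof (elim UnE)
  assume "s \<in> {M_aut V x \<epsilon> y | x y \<epsilon>. x \<in> X \<and> y \<in> Y \<and> \<epsilon> \<in> {1, -1}}"
  then obtain x y and \<epsilon> :: int
    where xy: "x \<in> X" "y \<in> Y" "\<epsilon> = 1 \<or> \<epsilon> = -1" "s = M_aut V x \<epsilon> y"
    by auto
  then have "x \<in> V" "y \<in> V"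
    by (simp_all add: V_iff)
  with xy show thesis
    using XZ[of x True False y] XZ[of x False True y] M_aut_eq[of x y] by auto
next
  assume "s \<in> {C_aut V z y | z y. z \<in> Z \<and> y \<in> Y}"
  then obtain z y where "z \<in> Z" "y \<in> Y" "s = C_aut V z y"
    by blast
  then show thesis
    using XZ[of z True True y] C_aut_eq[of y z] by (simp add: V_iff)
next
  assume "s \<in> {C_aut V y v | y v. y \<in> Y \<and> v \<in> V \<and> y \<noteq> v}"
  then show thesis
    using Y C_aut_eq by auto
qed

lemma kernel_moves_auto: "kernel_moves \<subseteq> auto F"
proof
  fix s
  assume "s \<in> kernel_moves"
  then show "s \<in> auto F"
    by (cases rule: kernel_moves_cases)
      (use disjoint in \<open>auto simp: V_iff intro!: side_transv_auto\<close>)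
qed

lemma move_group_subgroup: "subgroup move_group Aut"
  unfolding move_group_def using kernel_moves_auto
  by (intro Aut.generate_is_subgroup) (simp add: AutoGroup_simps)

lemma move_group_auto: "h \<in> move_group \<Longrightarrow> h \<in> auto F"
  using subgroup.mem_carrier[OF move_group_subgroup] by (simp add: AutoGroup_simps)

lemma conj_Y_in_move_group:
  assumes y: "y \<in> Y" and w: "w \<in> avoiding y"
  shows "side_transv True True y w \<in> move_group"
proof -
  have "y \<in> V"
    using y by (simp add: V_iff)
  then have sub: "subgroup {n \<in> avoiding y. side_transv True True y n \<in> move_group} F"
    using move_group_subgroup by (rule side_transv_subgroup)
  have "avoiding y \<subseteq> {n \<in> avoiding y. side_transv True True y n \<in> move_group}"
  proof (rule subgroup_of_free_group_contains[OF sub])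
    fix v
    assume v: "v \<in> V - {y}"
    then have "side_transv True True y (gen v) \<in> kernel_moves"
      using y C_aut_eq[of v y] unfolding kernel_moves_def by fastforce
    then show "gen v \<in> {n \<in> avoiding y. side_transv True True y n \<in> move_group}"
      using v unfolding move_group_def by (auto intro: generate.incl)
  qed blast
  with w show ?thesis
    by blast
qed

text \<open>Conjugating the generator with multiplier \<open>y\<close> by \<open>y \<mapsto> w y \<iota> w\<close>, which is in the group by
  \<open>conj_Y_in_move_group\<close> and fixes \<open>b\<close>, turns the multiplier into \<open>w y \<iota> w\<close>; these words generate
  \<open>kernel_part b\<close>.\<close>
lemma side_transv_in_move_group:
  assumes b: "b \<in> X \<and> l \<noteq> r \<or> b \<in> Z \<and> l \<and> r" and n: "n \<in> kernel_part b"
  shows "side_transv l r b n \<in> move_group"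
proof -
  have bV: "b \<in> V" and bY: "b \<notin> Y"
    using b disjoint by (auto simp: V_iff)
  have base: "side_transv l r b (gen y) \<in> move_group" if y: "y \<in> Y" for y
  proof -
    have "y \<in> V"
      using y by (simp add: V_iff)
    then have eq: "M_aut V b 1 y = side_transv True False b (gen y)"
      "M_aut V b (-1) y = side_transv False True b (gen y)"
      "C_aut V b y = side_transv True True b (gen y)"
      using bV by (simp_all add: M_aut_eq C_aut_eq)
    have "side_transv l r b (gen y) \<in> kernel_moves"
      using b y unfolding kernel_moves_def by (cases l; cases r) (simp_all flip: eq; fastforce)+
    then show ?thesis
      unfolding move_group_def by (rule generate.incl)
  qed
  have "kernel_part b \<subseteq> {n \<in> avoiding b. side_transv l r b n \<in> move_group}"
  proof (rule kernel_part_minimal)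
    show "subgroup {n \<in> avoiding b. side_transv l r b n \<in> move_group} F"
      using bV move_group_subgroup by (rule side_transv_subgroup)
    fix w y
    assume y: "y \<in> Y" and w: "w \<in> complement_words b"
    have yV: "y \<in> V" and yb: "y \<noteq> b"
      using y bY by (auto simp: V_iff)
    have wA: "w \<in> avoiding b" "w \<in> avoiding y" "w \<in> carrier F"
      using w y bY by (simp_all add: complement_closed)
    let ?m = "w \<cdot> gen y \<cdot> \<iota> w"
    let ?g = "side_transv True True y w"
    have m: "?m \<in> avoiding b"
      using wA yV yb by simp
    have g: "?g \<in> move_group"
      using conj_Y_in_move_group y wA by blast
    note hom = auto_hom[OF move_group_auto[OF g]]
    have ggen: "?g (gen c) = (if c = y then ?m else gen c)" if "c \<in> V" for c
      using that yV wA by (simp add: side_transv_def transv_gen)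
    have "side_transv l r b ?m \<in> move_group"
    proof (rule subgroup_conjugate_in[OF move_group_subgroup g base[OF y]])
      show "side_transv l r b ?m \<in> auto F"
        using bV m by (rule side_transv_auto)
      fix c
      assume c: "c \<in> V"
      consider "c = b" | "c = y" | "c \<noteq> b" "c \<noteq> y"
        by blast
      then show "?g (side_transv l r b (gen y) (gen c)) = side_transv l r b ?m (?g (gen c))"
      proof cases
        case 1
        then show ?thesis
          using bV yV yb m wA by (cases l; cases r) (simp_all add: side_transv_def[of _ _ b]
              transv_gen hom ggen)
      next
        case 2
        then show ?thesis
          using bV yV yb m wA by (cases l; cases r) (simp_all add: side_transv_def[of _ _ b]
              transv_gen transv_avoiding ggen)
      next
        case 3
        then show ?thesis
          using c bV yV yb m wA by (simp add: side_transv_def[of _ _ b] transv_gen ggen)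
      qed
    qed
    with m show "?m \<in> {n \<in> avoiding b. side_transv l r b n \<in> move_group}"
      by simp
  qed
  with n show ?thesis
    by blast
qed

lemma transv_in_move_group:
  assumes b: "b \<in> X \<union> Z" "b \<in> Z \<Longrightarrow> n' = \<iota> n" and n: "n \<in> kernel_part b" "n' \<in> kernel_part b"
  shows "transv b n n' \<in> move_group"
proof (cases "b \<in> Z")
  case True
  then show ?thesis
    using side_transv_in_move_group[of b True True n] b n by (simp add: side_transv_def)
next
  case False
  then have bX: "b \<in> X" and bV: "b \<in> V" and bY: "b \<notin> Y"
    using b disjoint by (auto simp: V_iff)
  have nA: "n \<in> avoiding b" "n' \<in> avoiding b"
    using n kernel_part_avoiding[OF bY] by auto
  then have nF: "n \<in> carrier F" "n' \<in> carrier F"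
    by (simp_all add: avoiding_closed(4)[of _ b])
  have "transv b n \<one>\<^bsub>F\<^esub> \<in> move_group" "transv b \<one>\<^bsub>F\<^esub> n' \<in> move_group"
    using side_transv_in_move_group[of b True False n] side_transv_in_move_group[of b False True "\<iota>
        n'"] bX n nF
    by (simp_all add: side_transv_def kernel_part_closed)
  then have "transv b n \<one>\<^bsub>F\<^esub> \<otimes>\<^bsub>Aut\<^esub> transv b \<one>\<^bsub>F\<^esub> n' \<in> move_group"
    by (rule subgroup.m_closed[OF move_group_subgroup])
  then show ?thesis
    using bV nA nF by (simp add: transv_mult)
qed

abbreviation base_words :: "'a word set" where
  "base_words \<equiv> carrier (free_group (X \<union> Z))"

text \<open>The last condition serves to move \<open>g\<close> to the right past elements of \<open>move_group\<close>; the others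
  force \<open>g\<close> to be the identity if it is trivial modulo \<open>Y\<close>.\<close>
definition base_normalizer :: "('a word \<Rightarrow> 'a word) set" where
  "base_normalizer = {g \<in> auto F. (\<forall>y \<in> Y. g (gen y) = gen y) \<and> (\<forall>u \<in> base_words. g u \<in> base_words)
     \<and> (\<forall>h \<in> move_group. g \<otimes>\<^bsub>Aut\<^esub> h \<otimes>\<^bsub>Aut\<^esub> inv\<^bsub>Aut\<^esub> g \<in> move_group)}"

lemma base_words_F: "w \<in> base_words \<Longrightarrow> w \<in> carrier F"
  by (erule free_group_mono[THEN subsetD, rotated]) (auto simp: V_iff)

lemma base_words_avoiding: "w \<in> base_words \<Longrightarrow> y \<in> Y \<Longrightarrow> w \<in> avoiding y"
  by (erule free_group_mono[THEN subsetD, rotated]) (use disjoint in \<open>auto simp: V_iff\<close>)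

lemma Y_words_avoiding:
  "n \<in> carrier (free_group Y) \<Longrightarrow> a \<in> X \<union> Z \<Longrightarrow> n \<in> avoiding a"
  by (erule free_group_mono[THEN subsetD, rotated]) (use disjoint in \<open>auto simp: V_iff\<close>)

lemma Y_words_kernel_part: "n \<in> carrier (free_group Y) \<Longrightarrow> n \<in> kernel_part a"
  by (erule subgroup_of_free_group_contains[OF kernel_part_subgroup, THEN subsetD, rotated -1])
    (auto simp: V_iff gen_in_kernel_part)

lemma base_words_subgroup: "subgroup base_words F"
  by (rule free_group_subgroup) (auto simp: V_iff)

lemma auto_maps_into:
  assumes f: "f \<in> auto F" and K: "subgroup K F" and S: "S \<subseteq> V" "\<And>a. a \<in> S \<Longrightarrow> f (gen a) \<in> K"
    and w: "w \<in> carrier (free_group S)"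
  shows "f w \<in> K"
proof -
  interpret K: subgroup K F
    by fact
  have "subgroup {w \<in> carrier F. f w \<in> K} F"
  proof (rule F.subgroupI)
    have "\<one>\<^bsub>F\<^esub> \<in> {w \<in> carrier F. f w \<in> K}"
      by (simp add: auto_hom[OF f])
    then show "{w \<in> carrier F. f w \<in> K} \<noteq> {}"
      by blast
  qed (auto simp: auto_hom[OF f])
  then have "carrier (free_group S) \<subseteq> {w \<in> carrier F. f w \<in> K}"
    by (rule subgroup_of_free_group_contains) (use S in auto)
  with w show ?thesis
    by blast
qed

lemma auto_fixes:
  assumes f: "f \<in> auto F" and S: "S \<subseteq> V" "\<And>a. a \<in> S \<Longrightarrow> f (gen a) = gen a"
    and w: "w \<in> carrier (free_group S)"
  shows "f w = w"
proof (rule hom_free_group_ext[OF autoD(1)[OF f] _ F.is_group S(1) _ w])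
  show "(\<lambda>w. w) \<in> hom F F"
    by (simp add: hom_def)
qed (use S in auto)

lemma base_normalizer_mult:
  assumes f: "f \<in> base_normalizer" and g: "g \<in> base_normalizer"
  shows "f \<otimes>\<^bsub>Aut\<^esub> g \<in> base_normalizer"
proof -
  have fg: "f \<in> auto F" "g \<in> auto F"
    using f g by (simp_all add: base_normalizer_def)
  have "(f \<otimes>\<^bsub>Aut\<^esub> g) \<otimes>\<^bsub>Aut\<^esub> h \<otimes>\<^bsub>Aut\<^esub> inv\<^bsub>Aut\<^esub> (f \<otimes>\<^bsub>Aut\<^esub> g) \<in> move_group" if h: "h \<in> move_group" for h
  proof -
    have c: "f \<in> carrier Aut" "g \<in> carrier Aut" "h \<in> carrier Aut"
      using fg move_group_auto[OF h] by (simp_all add: AutoGroup_simps)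
    then have "(f \<otimes>\<^bsub>Aut\<^esub> g) \<otimes>\<^bsub>Aut\<^esub> h \<otimes>\<^bsub>Aut\<^esub> inv\<^bsub>Aut\<^esub> (f \<otimes>\<^bsub>Aut\<^esub> g)
        = f \<otimes>\<^bsub>Aut\<^esub> (g \<otimes>\<^bsub>Aut\<^esub> h \<otimes>\<^bsub>Aut\<^esub> inv\<^bsub>Aut\<^esub> g) \<otimes>\<^bsub>Aut\<^esub> inv\<^bsub>Aut\<^esub> f"
      by (simp add: Aut.inv_mult_group Aut.m_assoc)
    then show ?thesis
      using f g h by (simp add: base_normalizer_def)
  qed
  then show ?thesis
    using f g fg base_words_F by (simp add: base_normalizer_def Aut_closed auto_mult V_iff)
qed

lemma conjugates_in_move_group:
  assumes g: "g \<in> auto F"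
    and moves: "\<And>s. s \<in> kernel_moves \<Longrightarrow> g \<otimes>\<^bsub>Aut\<^esub> s \<otimes>\<^bsub>Aut\<^esub> inv\<^bsub>Aut\<^esub> g \<in> move_group"
    and h: "h \<in> move_group"
  shows "g \<otimes>\<^bsub>Aut\<^esub> h \<otimes>\<^bsub>Aut\<^esub> inv\<^bsub>Aut\<^esub> g \<in> move_group"
proof -
  interpret H: subgroup move_group Aut
    by (rule move_group_subgroup)
  have gA: "g \<in> carrier Aut"
    using g by (simp add: AutoGroup_simps)
  have "h \<in> generate Aut kernel_moves"
    using h by (simp add: move_group_def)
  then show ?thesis
  proof (induction h rule: generate.induct)
    case one
    then show ?case
      using gA by simp
  next
    case (incl h)
    then show ?case
      by (rule moves)
  next
    case (inv h)
    have hA: "h \<in> carrier Aut"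
      using inv kernel_moves_auto by (auto simp: AutoGroup_simps)
    have "g \<otimes>\<^bsub>Aut\<^esub> inv\<^bsub>Aut\<^esub> h \<otimes>\<^bsub>Aut\<^esub> inv\<^bsub>Aut\<^esub> g = inv\<^bsub>Aut\<^esub> (g \<otimes>\<^bsub>Aut\<^esub> h \<otimes>\<^bsub>Aut\<^esub> inv\<^bsub>Aut\<^esub> g)"
      using gA hA by (simp add: Aut.inv_mult_group Aut.m_assoc)
    then show ?case
      using moves[OF inv] by simp
  next
    case (eng h k)
    have hA: "h \<in> carrier Aut" "k \<in> carrier Aut"
      using eng H.subset by (auto simp: move_group_def)
    have "g \<otimes>\<^bsub>Aut\<^esub> (h \<otimes>\<^bsub>Aut\<^esub> k) \<otimes>\<^bsub>Aut\<^esub> inv\<^bsub>Aut\<^esub> g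
        = (g \<otimes>\<^bsub>Aut\<^esub> h \<otimes>\<^bsub>Aut\<^esub> inv\<^bsub>Aut\<^esub> g) \<otimes>\<^bsub>Aut\<^esub> (g \<otimes>\<^bsub>Aut\<^esub> k \<otimes>\<^bsub>Aut\<^esub> inv\<^bsub>Aut\<^esub> g)"
      using gA hA by (simp add: Aut.m_assoc Aut.inv_solve_left)
    then show ?case
      using eng by simp
  qed
qed

text \<open>Generators that conjugate some \<open>a\<close> in \<open>Y\<close> by \<open>v\<close> are conjugated by any such \<open>g\<close> to the
  conjugation of \<open>a\<close> by \<open>g v\<close>. So only the generators that change a letter of \<open>X\<close> or \<open>Z\<close> are left
  as an assumption; they are treated in the form \<open>a \<mapsto> n a n'\<close>, which covers all of them at once.\<close>
lemma base_normalizerI: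
  assumes g: "g \<in> auto F"
    and fixY: "\<And>y. y \<in> Y \<Longrightarrow> g (gen y) = gen y"
    and base: "\<And>a. a \<in> X \<union> Z \<Longrightarrow> g (gen a) \<in> base_words"
    and commute: "\<And>a n n'. a \<in> X \<union> Z \<Longrightarrow> n \<in> carrier (free_group Y) \<Longrightarrow> n' \<in> carrier (free_group Y) \<Longrightarrow>
      (a \<in> Z \<Longrightarrow> n' = \<iota> n) \<Longrightarrow>
      \<exists>t \<in> move_group. \<forall>c \<in> V. g (transv a n n' (gen c)) = t (g (gen c))"
  shows "g \<in> base_normalizer"
proof -
  have gbase: "g w \<in> base_words" if "w \<in> base_words" for w
    by (rule auto_maps_into[OF g base_words_subgroup _ base that]) (auto simp: V_iff)
  have "g \<otimes>\<^bsub>Aut\<^esub> s \<otimes>\<^bsub>Aut\<^esub> inv\<^bsub>Aut\<^esub> g \<in> move_group" if s: "s \<in> kernel_moves" for s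
  proof -
    have sA: "s \<in> auto F"
      using s kernel_moves_auto by blast
    have "\<exists>t \<in> move_group. \<forall>c \<in> V. g (s (gen c)) = t (g (gen c))"
      using s
    proof (cases rule: kernel_moves_cases)
      case (Y a v)
      have aV: "a \<in> V"
        using Y by (simp add: V_iff)
      have "g (gen v) \<in> avoiding a"
      proof (cases "v \<in> Y")
        case True
        then show ?thesis
          using Y fixY by simp
      next
        case False
        then have "gen v \<in> base_words"
          using Y by (simp add: V_iff)
        then show ?thesis
          using Y gbase base_words_avoiding by blast
      qed
      note gv = this
      have vF: "gen v \<in> carrier F" "gen a \<in> carrier F"
        using Y aV by simp_all
      show ?thesis
      proof (intro bexI ballI)
        show "side_transv True True a (g (gen v)) \<in> move_group"
          using Y gv by (intro conj_Y_in_move_group)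
        fix c
        assume c: "c \<in> V"
        consider "c = a" | "c \<in> Y" "c \<noteq> a" | "c \<in> X \<union> Z"
          using c by (auto simp: V_iff)
        then show "g (s (gen c)) = side_transv True True a (g (gen v)) (g (gen c))"
        proof cases
          case 1
          then show ?thesis
            using Y aV gv vF fixY by (simp add: side_transv_def transv_gen auto_hom[OF g])
        next
          case 2
          then show ?thesis
            using Y aV gv vF c fixY by (simp add: side_transv_def transv_gen)
        next
          case 3
          then have "g (gen c) \<in> avoiding a" "c \<noteq> a"
            using Y base base_words_avoiding disjoint by auto
          then show ?thesis
            using Y aV gv vF c by (simp add: side_transv_def transv_gen transv_avoiding)
        qed
      qed
    next
      case (XZ a y l r)
      have y: "gen y \<in> carrier (free_group Y)" "gen y \<in> carrier F"
        using XZ by (simp_all add: V_iff)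
      interpret S: subgroup "carrier (free_group Y)" F
        by (rule free_group_subgroup) (auto simp: V_iff)
      show ?thesis
        using XZ y commute[of a "if l then gen y else \<one>\<^bsub>F\<^esub>" "if r then \<iota> (gen y) else \<one>\<^bsub>F\<^esub>"]
          disjoint by (fastforce simp: side_transv_def)
    qed
    then obtain t where "t \<in> move_group" "\<forall>c \<in> V. g (s (gen c)) = t (g (gen c))"
      by blast
    then show ?thesis
      using conjugate_eqI[OF g sA, of t] move_group_auto by simp
  qed
  then show ?thesis
    using g fixY gbase conjugates_in_move_group[OF g] by (simp add: base_normalizer_def)
qed

text \<open>Let \<open>g\<close> be \<open>b \<mapsto> u b u'\<close> and \<open>s\<close> be \<open>a \<mapsto> n a n'\<close>. If \<open>a = b\<close>, the conjugate of \<open>s\<close> by \<open>g\<close> is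
  again of this form, with multipliers conjugated by \<open>u\<close> and \<open>u'\<close>. If not, then it is \<open>s\<close> up to a
  change of \<open>b\<close>, whose multipliers compare \<open>u\<close> and \<open>u'\<close> with their images under \<open>s\<close>, and these are
  in \<open>kernel_part b\<close> by \<open>displacement_in_kernel_part\<close>.\<close>
lemma transv_base_normalizer:
  assumes b: "b \<in> X \<union> Z" "b \<in> Z \<Longrightarrow> u' = \<iota> u" and u: "u \<in> complement_words b" "u' \<in> complement_words b"
  shows "transv b u u' \<in> base_normalizer"
proof -
  interpret C: subgroup "complement_words b" F
    by (rule complement_subgroup)
  interpret B: subgroup base_words F
    by (rule base_words_subgroup)
  interpret S: subgroup "carrier (free_group Y)" F
    by (rule free_group_subgroup) (auto simp: V_iff)
  let ?g = "transv b u u'"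
  have bV: "b \<in> V" and bY: "b \<notin> Y"
    using b disjoint by (auto simp: V_iff)
  have uA: "u \<in> avoiding b" "u' \<in> avoiding b"
    using u bY complement_closed by auto
  have uF: "u \<in> carrier F" "u' \<in> carrier F"
    using u by simp_all
  have g: "?g \<in> auto F"
    using bV uA by (rule transv_auto)
  note gen_g = transv_gen[OF bV uA]
  note fix_g = transv_avoiding[OF bV uA]
  show ?thesis
  proof (rule base_normalizerI[OF g])
    fix y
    assume "y \<in> Y"
    then show "?g (gen y) = gen y"
      using gen_g[of y] bY by (auto simp: V_iff)
  next
    fix a
    assume a: "a \<in> X \<union> Z"
    have "u \<in> base_words" "u' \<in> base_words"
      using u free_group_mono[of "X \<union> Z - {b}" "X \<union> Z"] by auto
    then show "?g (gen a) \<in> base_words"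
      using a gen_g[of a] by (auto simp: V_iff)
  next
    fix a n n'
    assume a: "a \<in> X \<union> Z" "a \<in> Z \<Longrightarrow> n' = \<iota> n"
      and n: "n \<in> carrier (free_group Y)" "n' \<in> carrier (free_group Y)"
    let ?s = "transv a n n'"
    have aV: "a \<in> V"
      using a by (auto simp: V_iff)
    have na: "n \<in> avoiding a" "n' \<in> avoiding a" and nb: "n \<in> avoiding b" "n' \<in> avoiding b"
      using n a b Y_words_avoiding by blast+
    have nF: "n \<in> carrier F" "n' \<in> carrier F"
      using n by simp_all
    have s: "?s \<in> auto F"
      using aV na by (rule transv_auto)
    note gen_s = transv_gen[OF aV na]
    show "\<exists>t \<in> move_group. \<forall>c \<in> V. ?g (?s (gen c)) = t (?g (gen c))"
    proof (cases "a = b")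
      case True
      let ?m = "\<iota> u \<cdot> n \<cdot> u" and ?m' = "u' \<cdot> n' \<cdot> \<iota> u'"
      have m: "?m \<in> kernel_part b" "?m' \<in> kernel_part b"
        using kernel_part_conjugate[of "\<iota> u" b n] kernel_part_conjugate[of u' b n'] u n
          Y_words_kernel_part uF by simp_all
      have mA: "?m \<in> avoiding b" "?m' \<in> avoiding b"
        using m kernel_part_avoiding[OF bY] by auto
      have "transv b ?m ?m' \<in> move_group"
        using b(1) _ m
      proof (rule transv_in_move_group)
        assume "b \<in> Z"
        then show "?m' = \<iota> ?m"
          using b a True uF nF by (simp add: F.inv_mult_group F.m_assoc)
      qed
      moreover have "?g (?s (gen c)) = transv b ?m ?m' (?g (gen c))" if c: "c \<in> V" for c
      proof (cases "c = b")
        case c: True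
        interpret T: group_hom F F "transv b ?m ?m'"
          using transv_hom[OF bV mA] by unfold_locales
        have "transv b ?m ?m' (u \<cdot> gen b \<cdot> u') = u \<cdot> (?m \<cdot> gen b \<cdot> ?m') \<cdot> u'"
          using bV uF uA by (simp add: transv_avoiding[OF bV mA] transv_gen[OF bV mA])
        also have "\<dots> = ?g (n \<cdot> gen b \<cdot> n')"
          using bV uF nF nb fix_g gen_g[of b] by (simp add: auto_hom[OF g] F.m_assoc)
        finally show ?thesis
          using c True aV gen_s[of c] gen_g[of c] by simp
      next
        case False
        then show ?thesis
          using c True aV gen_s[of c] gen_g[of c] by (simp add: transv_gen[OF bV mA])
      qed
      ultimately show ?thesis
        by blast
    next
      case False
      let ?m = "\<iota> (?s u) \<cdot> u" and ?m' = "u' \<cdot> \<iota> (?s u')"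
      have suA: "?s w \<in> avoiding b" if "w \<in> avoiding b" for w
      proof (rule auto_maps_into[OF s free_group_subgroup _ _ that])
        fix c
        assume "c \<in> V - {b}"
        then show "?s (gen c) \<in> avoiding b"
          using gen_s[of c] nb False aV by auto
      qed auto
      have suF: "?s u \<in> carrier F" "?s u' \<in> carrier F"
        using uF auto_hom[OF s] by auto
      have m: "?m \<in> kernel_part b"
        using a(1) False n u(1) by (rule displacement_in_kernel_part)
      have "\<iota> (?s (\<iota> u')) \<cdot> \<iota> u' \<in> kernel_part b"
        using a(1) False n by (rule displacement_in_kernel_part) (use u in simp)
      moreover have "?m' = \<iota> (\<iota> (?s (\<iota> u')) \<cdot> \<iota> u')"
        using uF suF by (simp add: auto_hom[OF s] F.inv_mult_group)
      ultimately have m': "?m' \<in> kernel_part b"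
        using kernel_part_closed by simp
      have mA: "?m \<in> avoiding b" "?m' \<in> avoiding b"
        using m m' kernel_part_avoiding[OF bY] by auto
      have e: "transv b ?m ?m' \<in> move_group"
        using b(1) _ m m'
      proof (rule transv_in_move_group)
        assume "b \<in> Z"
        then show "?m' = \<iota> ?m"
          using b(2) uF suF by (simp add: auto_hom[OF s] F.inv_mult_group)
      qed
      have sH: "?s \<in> move_group"
        using a n Y_words_kernel_part by (intro transv_in_move_group) auto
      have "?g (?s (gen c)) = (transv b ?m ?m' \<otimes>\<^bsub>Aut\<^esub> ?s) (?g (gen c))" if c: "c \<in> V" for c
      proof -
        have eA: "transv b ?m ?m' \<in> auto F"
          using e by (rule move_group_auto)
        have "?g (gen c) \<in> carrier F"
          using auto_hom(4)[OF g] c by simp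
        then have comp: "(transv b ?m ?m' \<otimes>\<^bsub>Aut\<^esub> ?s) (?g (gen c)) = transv b ?m ?m' (?s (?g (gen c)))"
          using eA s by (simp add: auto_mult)
        consider "c = b" | "c = a" | "c \<noteq> a" "c \<noteq> b"
          by blast
        then show ?thesis
        proof cases
          case 1
          have "transv b ?m ?m' (?s (u \<cdot> gen b \<cdot> u')) = u \<cdot> gen b \<cdot> u'"
            using bV uF suF uA suA mA False gen_s[of b]
            by (simp add: auto_hom[OF s] auto_hom[OF eA] transv_avoiding[OF bV mA]
                transv_gen[OF bV mA] F.m_assoc)
          then show ?thesis
            using 1 c False gen_s[of b] gen_g[of b] comp by simp
        next
          case 2
          have "n \<cdot> gen a \<cdot> n' \<in> avoiding b"
            using nb aV False by simp
          then show ?thesis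
            using 2 c False gen_s[of a] gen_g[of a] comp fix_g transv_avoiding[OF bV mA] by simp
        next
          case 3
          then show ?thesis
            using c gen_s[of c] gen_g[of c] comp transv_gen[OF bV mA, of c] by simp
        qed
      qed
      moreover have "transv b ?m ?m' \<otimes>\<^bsub>Aut\<^esub> ?s \<in> move_group"
        using e sH subgroup.m_closed[OF move_group_subgroup] by blast
      ultimately show ?thesis
        by blast
    qed
  qed
qed

lemma letter_word: "[(a, True)] = gen a" "a \<in> V \<Longrightarrow> [(a, False)] = \<iota> (gen a)"
  using inv_free_group[of "gen a" V] by (simp_all add: gen_def flip_def in_free_group)

text \<open>Such a \<open>g\<close> permutes the automorphisms \<open>a \<mapsto> n a n'\<close>; when it maps \<open>a\<close> to an inverse letter,
  the left and the right multiplier change places and get inverted, which is the reason for \<open>p\<close>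
  and \<open>p'\<close>.\<close>
lemma signed_permutation_base_normalizer:
  assumes g: "g \<in> auto F"
    and fixP: "\<And>a. a \<in> Y \<union> Z \<Longrightarrow> g (gen a) = gen a"
    and perm: "\<And>x. x \<in> X \<Longrightarrow> \<exists>x' \<in> X. \<exists>\<epsilon>. g (gen x) = [(x', \<epsilon>)]"
  shows "g \<in> base_normalizer"
proof (rule base_normalizerI[OF g])
  show "g (gen y) = gen y" if "y \<in> Y" for y
    using that fixP by simp
next
  fix a
  assume a: "a \<in> X \<union> Z"
  show "g (gen a) \<in> base_words"
  proof (cases "a \<in> Z")
    case True
    then show ?thesis
      using fixP by simp
  next
    case False
    then obtain x' \<epsilon> where "x' \<in> X" "g (gen a) = [(x', \<epsilon>)]"
      using a perm by blast
    then show ?thesis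
      by (simp add: in_free_group)
  qed
next
  fix a n n'
  assume a: "a \<in> X \<union> Z" "a \<in> Z \<Longrightarrow> n' = \<iota> n"
    and n: "n \<in> carrier (free_group Y)" "n' \<in> carrier (free_group Y)"
  interpret S: subgroup "carrier (free_group Y)" F
    by (rule free_group_subgroup) (auto simp: V_iff)
  let ?s = "transv a n n'"
  have YA: "n \<in> avoiding b" "n' \<in> avoiding b" if "b \<in> X \<union> Z" for b
    using that n Y_words_avoiding by blast+
  have nK: "n \<in> kernel_part b" "n' \<in> kernel_part b" for b
    using n Y_words_kernel_part by blast+
  have nF: "n \<in> carrier F" "n' \<in> carrier F"
    using n by simp_all
  have aV: "a \<in> V"
    using a by (auto simp: V_iff)
  have YV: "Y \<subseteq> V"
    by (auto simp: V_iff)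
  have gn: "g n = n" "g n' = n'"
    using n by (auto intro: auto_fixes[OF g YV fixP])
  note gen_s = transv_gen[OF aV YA[OF a(1)]]
  show "\<exists>t \<in> move_group. \<forall>c \<in> V. g (?s (gen c)) = t (g (gen c))"
  proof (cases "a \<in> Z")
    case True
    have "g (?s (gen c)) = ?s (g (gen c))" if c: "c \<in> V" for c
    proof -
      consider "c = a" | "c \<in> Y \<union> Z" "c \<noteq> a" | "c \<in> X" "c \<noteq> a"
        using c by (auto simp: V_iff)
      then show ?thesis
      proof cases
        case 1
        then show ?thesis
          using True aV gen_s[of a] fixP[of a] gn nF by (simp add: auto_hom[OF g])
      next
        case 2
        then show ?thesis
          using c gen_s[of c] fixP[of c] by simp
      next
        case 3
        then obtain x' \<epsilon> where x': "x' \<in> X" "g (gen c) = [(x', \<epsilon>)]"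
          using perm by blast
        then have "[(x', \<epsilon>)] \<in> avoiding a"
          using True disjoint by (auto simp: in_free_group V_iff)
        then show ?thesis
          using 3 c x' gen_s[of c] transv_avoiding[OF aV YA[OF a(1)]] by simp
      qed
    qed
    moreover have "?s \<in> move_group"
      using a nK by (intro transv_in_move_group) auto
    ultimately show ?thesis
      by blast
  next
    case False
    then have aX: "a \<in> X"
      using a by blast
    obtain a' \<epsilon> where a': "a' \<in> X" "g (gen a) = [(a', \<epsilon>)]"
      using perm[OF aX] by blast
    have aV': "a' \<in> V" "a' \<in> X \<union> Z" and aZ': "a' \<notin> Z"
      using a' disjoint by (auto simp: V_iff)
    define p p' where "p = (if \<epsilon> then n else \<iota> n')" and "p' = (if \<epsilon> then n' else \<iota> n)"
    have pA: "p \<in> avoiding a'" "p' \<in> avoiding a'"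
      using YA[OF aV'(2)] by (simp_all add: p_def p'_def)
    interpret T: group_hom F F "transv a' p p'"
      using transv_hom[OF aV'(1) pA] by unfold_locales
    have "g (?s (gen c)) = transv a' p p' (g (gen c))" if c: "c \<in> V" for c
    proof -
      consider "c = a" | "c \<in> Y \<union> Z" "c \<noteq> a" | "c \<in> X" "c \<noteq> a"
        using c by (auto simp: V_iff)
      then show ?thesis
      proof cases
        case 1
        have "n \<cdot> [(a', \<epsilon>)] \<cdot> n' = transv a' p p' [(a', \<epsilon>)]"
          using aV' nF transv_gen[OF aV'(1) pA, of a'] T.hom_inv[of "gen a'"]
          by (cases \<epsilon>) (simp_all add: letter_word p_def p'_def F.inv_mult_group F.m_assoc)
        then show ?thesis
          using 1 a' aV gen_s[of a] gn nF by (simp add: auto_hom[OF g])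
      next
        case 2
        then have "c \<noteq> a'"
          using a' disjoint by auto
        then show ?thesis
          using 2 c gen_s[of c] fixP[of c] transv_gen[OF aV'(1) pA, of c] by simp
      next
        case 3
        then obtain c' \<delta> where c': "c' \<in> X" "g (gen c) = [(c', \<delta>)]"
          using perm by blast
        have "c' \<noteq> a'"
        proof
          assume eq: "c' = a'"
          have "g (gen c) = g (gen a) \<or> g (gen c) = g (\<iota> (gen a))"
            using a' c' eq aV aV' by (cases \<epsilon>; cases \<delta>) (simp_all add: letter_word auto_hom[OF g])
          moreover have "inj_on g (carrier F)"
            using autoD(2)[OF g] by (simp add: bij_betw_def)
          ultimately have "gen c = gen a \<or> gen c = \<iota> (gen a)"
            using aV c by (auto dest: inj_onD)
          then show False
            using 3 letter_word(2)[OF aV, symmetric] by (auto simp: gen_def)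
        qed
        then have "[(c', \<delta>)] \<in> avoiding a'"
          using c' by (auto simp: in_free_group V_iff)
        then show ?thesis
          using 3 c c' gen_s[of c] transv_avoiding[OF aV'(1) pA] by simp
      qed
    qed
    moreover have "transv a' p p' \<in> move_group"
      using aV' aZ' nK by (intro transv_in_move_group) (auto simp: p_def p'_def kernel_part_closed)
    ultimately show ?thesis
      by blast
  qed
qed

end

section \<open>Nielsen reduction of automorphisms\<close>

lemma (in group) conj_class_eq_iff:
  assumes "x \<in> carrier G" "y \<in> carrier G"
  shows "conj_class G x = conj_class G y \<longleftrightarrow> (\<exists>k \<in> carrier G. x = k \<otimes> y \<otimes> inv k)"
proof
  assume eq: "conj_class G x = conj_class G y"
  have "x \<in> conj_class G x"
    using assms unfolding conj_class_def by (intro CollectI exI[of _ \<one>]) simp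
  with eq show "\<exists>k \<in> carrier G. x = k \<otimes> y \<otimes> inv k"
    by (auto simp: conj_class_def)
next
  have sub: "conj_class G (k \<otimes> y \<otimes> inv k) \<subseteq> conj_class G y" if "k \<in> carrier G" "y \<in> carrier G" for k y
  proof
    fix g
    assume "g \<in> conj_class G (k \<otimes> y \<otimes> inv k)"
    then obtain h where "h \<in> carrier G" "g = h \<otimes> (k \<otimes> y \<otimes> inv k) \<otimes> inv h"
      by (auto simp: conj_class_def)
    then show "g \<in> conj_class G y"
      using that unfolding conj_class_def
      by (intro CollectI exI[of _ "h \<otimes> k"]) (simp add: inv_mult_group m_assoc)
  qed
  assume "\<exists>k \<in> carrier G. x = k \<otimes> y \<otimes> inv k"
  then obtain k where k: "k \<in> carrier G" "x = k \<otimes> y \<otimes> inv k"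
    by blast
  have "inv k \<otimes> x \<otimes> inv (inv k) = inv k \<otimes> k \<otimes> y \<otimes> (inv k \<otimes> k)"
    using k(1) assms unfolding k(2) by (simp only: m_assoc m_closed inv_closed inv_inv)
  then have "y = inv k \<otimes> x \<otimes> inv (inv k)"
    using k(1) assms by simp
  then have "conj_class G y \<subseteq> conj_class G x"
    using sub[of "inv k" x] k assms by simp
  moreover have "conj_class G x \<subseteq> conj_class G y"
    using sub[of k y] k assms by simp
  ultimately show "conj_class G x = conj_class G y"
    by blast
qed

text \<open>Conjugating \<open>A s A\<^sup>-\<close> by one more letter \<open>t\<close> prolongs \<open>A\<close> by \<open>t\<close>, or cancels the first
  letter of \<open>A\<close>, or, when \<open>A\<close> is empty and \<open>t\<close> is \<open>s\<close> or its inverse, changes nothing. Hence a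
  conjugate of a letter has the symmetric shape that Nielsen's argument needs for the images of
  peripheral letters.\<close>
lemma reduce_conjugate_letter:
  "\<exists>A. reduced (A @ [s] @ winv A) \<and> reduce (h @ [s] @ winv h) = A @ [s] @ winv A"
proof (induction h)
  case Nil
  show ?case
    by (rule exI[of _ "[]"]) simp
next
  case (Cons t h)
  then obtain A where A: "reduced (A @ [s] @ winv A)" "reduce (h @ [s] @ winv h) = A @ [s] @ winv A"
    by blast
  have "reduce ((t # h) @ [s] @ winv (t # h)) = reduce ([t] @ (h @ [s] @ winv h) @ [flip t])"
    by simp
  also have "\<dots> = reduce ([t] @ reduce (reduce (h @ [s] @ winv h) @ [flip t]))"
    by (simp only: reduce_reduce_left reduce_reduce_right)
  also have "\<dots> = reduce ([t] @ A @ [s] @ winv A @ [flip t])"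
    by (simp only: A(2) reduce_reduce_right append_assoc)
  finally have eq: "reduce ((t # h) @ [s] @ winv (t # h)) = reduce ([t] @ A @ [s] @ winv A @ [flip
      t])" .
  show ?case
  proof (cases A)
    case Nil
    show ?thesis
    proof (cases "t = s \<or> t = flip s")
      case True
      then have "reduce ([t] @ A @ [s] @ winv A @ [flip t]) = [s]"
        using Nil by (auto simp: reduce_def cancels_iff)
      then show ?thesis
        unfolding eq by (intro exI[of _ "[]"]) simp
    next
      case False
      then have "reduced ([t] @ [s] @ winv [t])"
        by (auto simp: reduced_Cons)
      then show ?thesis
        unfolding eq using Nil by (intro exI[of _ "[t]"]) simp
    qed
  next
    case (Cons a A')
    show ?thesis
    proof (cases "a = flip t")
      case True
      have "reduced (A' @ [s] @ winv A')"
        using A(1) Cons by (auto simp: reduced_Cons reduced_append)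
      moreover have "reduce ([t] @ A @ [s] @ winv A @ [flip t]) = reduce (A' @ [s] @ winv A')"
        using Cons True reduce_cancel[of "[]" "[t]" "A' @ [s] @ winv A' @ [t, flip t]"]
          reduce_cancel[of "A' @ [s] @ winv A'" "[t]" "[]"] by simp
      ultimately show ?thesis
        unfolding eq by (intro exI[of _ A']) simp
    next
      case False
      let ?M = "A @ [s] @ winv A"
      have "hd ?M = a" "last ?M = flip a" "?M \<noteq> []"
        using Cons by simp_all
      then have "reduced (?M @ [flip t])"
        using A(1) False unfolding reduced_append[of ?M] by simp
      then have "reduced (t # ?M @ [flip t])"
        using False Cons by (simp add: reduced_Cons)
      then have "reduced ((t # A) @ [s] @ winv (t # A))"
        by simp
      then show ?thesis
        unfolding eq by (intro exI[of _ "t # A"]) simp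
    qed
  qed
qed

text \<open>Read words as numerals to a base larger than the number of digits. Comparing words of equal
  length is then lexicographic.\<close>
lemma exists_word_numbering:
  assumes "finite V"
  shows "\<exists>num :: 'a word \<Rightarrow> nat.
    (\<forall>d e r. length d = length e \<longrightarrow> num d < num e \<longrightarrow> num (d @ r) < num (e @ r)) \<and>
    (\<forall>d e. length d = length e \<longrightarrow> fst ` set d \<subseteq> V \<longrightarrow> fst ` set e \<subseteq> V \<longrightarrow> num d = num e \<longrightarrow> d = e)"
proof -
  have fin: "finite (V \<times> (UNIV :: bool set))"
    using assms by simp
  obtain dg :: "'a \<times> bool \<Rightarrow> nat" and m where dg: "dg ` (V \<times> UNIV) = {i. i < m}" "inj_on dg (V \<times> UNIV)"
    using finite_imp_inj_to_nat_seg[OF fin] by (elim exE conjE) (rule that)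
  define B where "B = Suc m"
  then have B0: "B \<noteq> 0"
    by simp
  define num where "num = foldl (\<lambda>n s. n * B + dg s) 0"
  have dgB: "dg s < B" if "fst s \<in> V" for s
  proof -
    have "s \<in> V \<times> UNIV"
      using that by (cases s) auto
    then have "dg s \<in> {i. i < m}"
      using dg(1) by blast
    then show ?thesis
      by (simp add: B_def)
  qed
  have num_snoc: "num (w @ [s]) = num w * B + dg s" for w s
    by (simp add: num_def)
  have less: "num (d @ r) < num (e @ r)" if "num d < num e" for d e r
  proof (induction r rule: rev_induct)
    case Nil
    then show ?case
      using that by simp
  next
    case (snoc s r)
    then have "num (d @ r) * B < num (e @ r) * B"
      by (intro mult_strict_right_mono) (simp_all add: B_def)
    then show ?case
      using num_snoc[of "d @ r" s] num_snoc[of "e @ r" s] by simp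
  qed
  have inj: "length d = length e \<Longrightarrow> fst ` set d \<subseteq> V \<Longrightarrow> fst ` set e \<subseteq> V \<Longrightarrow> num d = num e \<Longrightarrow> d = e" for d e
  proof (induction d arbitrary: e rule: rev_induct)
    case (snoc s d)
    then obtain e' t where e: "e = e' @ [t]"
      by (cases e rule: rev_cases) auto
    have V: "fst s \<in> V" "fst t \<in> V"
      using snoc.prems e by auto
    have eq: "num d * B + dg s = num e' * B + dg t"
      using snoc.prems(4) num_snoc unfolding e by simp
    have "(num d * B + dg s) mod B = dg s" "(num e' * B + dg t) mod B = dg t"
      using dgB V by simp_all
    then have dgst: "dg s = dg t"
      using eq by simp
    then have "num d * B = num e' * B"
      using eq by simp
    then have "num d = num e'"
      using B0 by simp
    moreover have "s = t"
      using dgst V by (intro inj_onD[OF dg(2)]) (simp_all add: mem_Times_iff)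
    ultimately show ?case
      using snoc.IH[of e'] snoc.prems e by auto
  qed simp
  show ?thesis
    by (intro exI[of _ num] conjI allI impI less inj)
qed

context free_group_on
begin

lemma auto_word:
  assumes f: "f \<in> auto F" and w: "w \<in> carrier F"
  shows "f w = reduce (concat (map (\<lambda>s. f [s]) w))"
  using w
proof (induction w)
  case Nil
  then show ?case
    using auto_hom(3)[OF f] by (simp add: one_free_group reduce_def)
next
  case (Cons s w)
  then have *: "[s] \<in> carrier F" "w \<in> carrier F" "s # w = [s] \<cdot> w"
    by (simp_all add: in_free_group reduced_Cons mult_free_group)
  then have "f (s # w) = reduce (f [s] @ f w)"
    using auto_hom(1)[OF f, of "[s]" w] by (simp add: mult_free_group)
  then show ?case
    using Cons.IH *(2) by simp
qed

lemma auto_inj: "f \<in> auto F \<Longrightarrow> u \<in> carrier F \<Longrightarrow> v \<in> carrier F \<Longrightarrow> f u = f v \<Longrightarrow> u = v"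
  using autoD(2) by (metis bij_betw_def inj_onD)

lemma single_in_F [simp]: "[s] \<in> carrier F \<longleftrightarrow> fst s \<in> V"
  by (simp add: in_free_group)

lemma auto_flip:
  assumes "f \<in> auto F" "fst s \<in> V"
  shows "f [flip s] = winv (f [s])"
proof -
  have "[flip s] = \<iota> [s]"
    using assms by (simp add: inv_free_group)
  then show ?thesis
    using assms auto_hom(2,4)[OF assms(1), of "[s]"] inv_free_group by simp
qed

end

context peripheral_letters
begin

definition class_preserving :: "('a word \<Rightarrow> 'a word) set" where
  "class_preserving = {f \<in> auto F. \<forall>p \<in> Y \<union> Z. conj_class F (f (gen p)) = conj_class F (gen p)}"

lemma class_preserving_iff:
  "f \<in> class_preserving \<longleftrightarrow>
    f \<in> auto F \<and> (\<forall>p \<in> Y \<union> Z. \<exists>k \<in> carrier F. f (gen p) = k \<cdot> gen p \<cdot> \<iota> k)"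
proof (cases "f \<in> auto F")
  case True
  have "conj_class F (f (gen p)) = conj_class F (gen p) \<longleftrightarrow> (\<exists>k \<in> carrier F. f (gen p) = k \<cdot> gen p \<cdot> \<iota>
      k)"
    if "p \<in> Y \<union> Z" for p
  proof (rule F.conj_class_eq_iff)
    show "gen p \<in> carrier F"
      using that by (auto simp: V_iff)
    then show "f (gen p) \<in> carrier F"
      by (rule auto_hom(4)[OF True])
  qed
  then have "(\<forall>p \<in> Y \<union> Z. conj_class F (f (gen p)) = conj_class F (gen p)) \<longleftrightarrow>
      (\<forall>p \<in> Y \<union> Z. \<exists>k \<in> carrier F. f (gen p) = k \<cdot> gen p \<cdot> \<iota> k)"
    by (rule ball_cong[OF refl])
  then show ?thesis
    by (simp only: class_preserving_def mem_Collect_eq)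
qed (simp add: class_preserving_def)

lemma class_preserving_mult:
  assumes f: "f \<in> class_preserving" and g: "g \<in> class_preserving"
  shows "f \<otimes>\<^bsub>Aut\<^esub> g \<in> class_preserving"
proof -
  have fg: "f \<in> auto F" "g \<in> auto F"
    using f g by (simp_all add: class_preserving_iff)
  have "\<exists>k \<in> carrier F. (f \<otimes>\<^bsub>Aut\<^esub> g) (gen p) = k \<cdot> gen p \<cdot> \<iota> k" if p: "p \<in> Y \<union> Z" for p
  proof -
    obtain k j where k: "k \<in> carrier F" "f (gen p) = k \<cdot> gen p \<cdot> \<iota> k"
      and j: "j \<in> carrier F" "g (gen p) = j \<cdot> gen p \<cdot> \<iota> j"
      using f g p unfolding class_preserving_iff by blast
    have pV: "gen p \<in> carrier F"
      using p by (auto simp: V_iff)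
    then have "(f \<otimes>\<^bsub>Aut\<^esub> g) (gen p) = (f j \<cdot> k) \<cdot> gen p \<cdot> \<iota> (f j \<cdot> k)"
      using k j fg by (simp add: auto_mult auto_hom F.inv_mult_group F.m_assoc)
    then show ?thesis
      using k j fg auto_hom(4) by (intro bexI[of _ "f j \<cdot> k"]) auto
  qed
  then show ?thesis
    using fg by (simp add: class_preserving_iff Aut_closed)
qed

text \<open>The letters of \<open>X\<close> may be multiplied on either side; conjugation is possible for every
  letter.\<close>

definition elementary :: "'a \<Rightarrow> 'a word \<Rightarrow> 'a word \<Rightarrow> bool" where
  "elementary b u u' \<longleftrightarrow> b \<in> V \<and> (\<exists>s. fst s \<in> V - {b} \<and>
     (u = [s] \<and> u' = \<iota> [s] \<or> b \<in> X \<and> (u = [s] \<and> u' = \<one>\<^bsub>F\<^esub> \<or> u = \<one>\<^bsub>F\<^esub> \<and> u' = [s])))"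

lemma elementary_avoiding:
  assumes "elementary b u u'"
  shows "b \<in> V" "u \<in> avoiding b" "u' \<in> avoiding b"
proof -
  have "[s] \<in> avoiding b" if "fst s \<in> V - {b}" for s
    using that by (simp add: in_free_group)
  then show "b \<in> V" "u \<in> avoiding b" "u' \<in> avoiding b"
    using assms unfolding elementary_def by auto
qed

lemma elementary_class_preserving:
  assumes e: "elementary b u u'"
  shows "transv b u u' \<in> class_preserving"
proof -
  note bu = elementary_avoiding[OF e]
  have "\<exists>k \<in> carrier F. transv b u u' (gen p) = k \<cdot> gen p \<cdot> \<iota> k" if p: "p \<in> Y \<union> Z" for p
  proof (cases "p = b")
    case True
    then have "b \<notin> X"
      using p disjoint by auto
    then have "u' = \<iota> u"
      using e by (auto simp: elementary_def)
    then show ?thesis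
      using True bu transv_gen[OF bu, of b] by (intro bexI[of _ u]) (auto simp:
          avoiding_closed(4)[of _ b])
  next
    case False
    then show ?thesis
      using p transv_gen[OF bu, of p] by (intro bexI[of _ "\<one>\<^bsub>F\<^esub>"]) (auto simp: V_iff)
  qed
  then show ?thesis
    using transv_auto[OF bu] by (simp add: class_preserving_iff)
qed

text \<open>The inverse, rather than the automorphism itself, is what \<open>factorization\<close> multiplies with.\<close>
lemma elementary_inverse:
  assumes e: "elementary b u u'"
  shows "inv\<^bsub>Aut\<^esub> transv b u u' \<in> move_group \<union> base_normalizer"
proof -
  note bu = elementary_avoiding[OF e]
  have uF: "u \<in> carrier F" "u' \<in> carrier F"
    using bu by (simp_all add: avoiding_closed(4)[of _ b])
  obtain s where s: "fst s \<in> V - {b}"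
    and us: "u = [s] \<and> u' = \<iota> [s] \<or> b \<in> X \<and> (u = [s] \<and> u' = \<one>\<^bsub>F\<^esub> \<or> u = \<one>\<^bsub>F\<^esub> \<and> u' = [s])"
    using e unfolding elementary_def by blast
  have "transv b (\<iota> u) (\<iota> u') \<in> move_group \<union> base_normalizer"
  proof (cases "b \<in> Y")
    case True
    then have "b \<notin> X"
      using disjoint by auto
    then have "u' = \<iota> u"
      using us by auto
    then have "transv b (\<iota> u) (\<iota> u') = side_transv True True b (\<iota> u)"
      by (simp add: side_transv_def)
    then show ?thesis
      using conj_Y_in_move_group[OF True, of "\<iota> u"] bu by simp
  next
    case False
    then have b: "b \<in> X \<union> Z"
      using bu by (auto simp: V_iff)
    have uZ: "u' = \<iota> u" if "b \<in> Z"
      using that us disjoint by auto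
    show ?thesis
    proof (cases "fst s \<in> Y")
      case True
      then have "[s] \<in> kernel_part b"
        by (intro Y_words_kernel_part) (simp add: in_free_group)
      then have "u \<in> kernel_part b" "u' \<in> kernel_part b"
        using us kernel_part_closed by auto
      then have "transv b (\<iota> u) (\<iota> u') \<in> move_group"
        using b uZ by (intro transv_in_move_group) (simp_all add: kernel_part_closed)
      then show ?thesis
        by blast
    next
      case False
      interpret C: subgroup "complement_words b" F
        by (rule complement_subgroup)
      have "[s] \<in> complement_words b"
        using False s by (auto simp: in_free_group V_iff)
      then have "u \<in> complement_words b" "u' \<in> complement_words b"
        using us by auto
      then have "transv b (\<iota> u) (\<iota> u') \<in> base_normalizer"
        using b uZ by (intro transv_base_normalizer) simp_all
      then show ?thesis
        by blast
    qed
  qed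
  then show ?thesis
    using bu by (simp add: transv_inv)
qed

text \<open>The link between automorphisms and tuples: precomposition with an elementary automorphism is
  an elementary move on the tuple of images.\<close>
lemma minimal_or_improvable:
  assumes f: "f \<in> class_preserving"
    and num: "\<And>d e r. length d = length e \<Longrightarrow> num d < num e \<Longrightarrow> num (d @ r) < num (e @ r)"
      "\<And>d e. length d = length e \<Longrightarrow> fst ` set d \<subseteq> V \<Longrightarrow> fst ` set e \<subseteq> V \<Longrightarrow> num d = num e \<Longrightarrow> d = e"
    and stuck: "\<And>b u u'. elementary b u u' \<Longrightarrow> \<not> better num ((f \<otimes>\<^bsub>Aut\<^esub> transv b u u') (gen b)) (f (gen
        b))"
  shows "minimal_tuple V (Y \<union> Z) (\<lambda>s. f [s]) num"
proof -
  have fA: "f \<in> auto F"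
    using f by (simp add: class_preserving_iff)
  have fF: "f [s] \<in> carrier F" if "fst s \<in> V" for s
    using auto_hom(4)[OF fA] that by simp
  have move: "\<not> better num (f u \<cdot> f (gen b) \<cdot> f u') (f (gen b))" if e: "elementary b u u'" for b u u'
  proof -
    note bu = elementary_avoiding[OF e]
    have "(f \<otimes>\<^bsub>Aut\<^esub> transv b u u') (gen b) = f u \<cdot> f (gen b) \<cdot> f u'"
      using bu fA transv_auto[OF bu]
      by (simp add: auto_mult transv_gen auto_hom avoiding_closed(4)[of _ b])
    then show ?thesis
      using stuck[OF e] by simp
  qed
  have winv_inv: "winv w = \<iota> w" if "w \<in> carrier F" for w
    using that by (simp add: inv_free_group)
  show ?thesis
  proof
    fix d e r :: "'a word"
    assume "length d = length e" "num d < num e"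
    then show "num (d @ r) < num (e @ r)"
      by (rule num(1))
  next
    fix d e :: "'a word"
    assume "length d = length e" "fst ` set d \<subseteq> V" "fst ` set e \<subseteq> V" "num d = num e"
    then show "d = e"
      by (rule num(2))
  next
    fix s :: "'a \<times> bool"
    assume s: "fst s \<in> V"
    then show "reduced (f [s])" "fst ` set (f [s]) \<subseteq> V"
      using fF[OF s] by (simp_all add: in_free_group)
    show "f [s] \<noteq> []"
    proof
      assume "f [s] = []"
      then have "f [s] = f \<one>\<^bsub>F\<^esub>"
        using auto_hom(3)[OF fA] by (simp add: one_free_group)
      then have "[s] = \<one>\<^bsub>F\<^esub>"
        using auto_inj[OF fA] s by simp
      then show False
        by (simp add: one_free_group)
    qed
    show "f [flip s] = winv (f [s])"
      using fA s by (rule auto_flip)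
  next
    fix t :: "'a \<times> bool"
    assume t: "fst t \<in> Y \<union> Z"
    then have tV: "fst t \<in> V"
      by (auto simp: V_iff)
    obtain k where k: "k \<in> carrier F" "f (gen (fst t)) = k \<cdot> gen (fst t) \<cdot> \<iota> k"
      using f t unfolding class_preserving_iff by blast
    have "f [(fst t, True)] = reduce (k @ [(fst t, True)] @ winv k)"
      using k by (simp add: mult_free_group inv_free_group gen_def)
    then obtain A where A: "f [(fst t, True)] = A @ [(fst t, True)] @ winv A"
      using reduce_conjugate_letter[of "(fst t, True)" k] by auto
    show "\<exists>A. f [t] = A @ [t] @ winv A"
    proof (cases "snd t")
      case True
      then have "(fst t, True) = t"
        by (simp add: prod_eq_iff)
      then show ?thesis
        using A by auto
    next
      case False
      then have "flip (fst t, True) = t"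
        by (simp add: flip_def prod_eq_iff)
      then have "f [t] = A @ [t] @ winv A"
        using auto_flip[OF fA, of "(fst t, True)"] tV by (simp add: A)
      then show ?thesis
        by blast
    qed
  next
    fix s t :: "'a \<times> bool"
    assume s: "fst s \<in> V" and t: "fst t \<in> V - (Y \<union> Z)" and neq: "fst s \<noteq> fst t"
    then have tX: "fst t \<in> X" "fst t \<in> V"
      by (auto simp: V_iff)
    have gt: "f (gen (fst t)) \<in> carrier F" "f [s] \<in> carrier F"
      using fF[of s] auto_hom(4)[OF fA, of "gen (fst t)"] s tX by simp_all
    show "\<not> better num (reduce (f [s] @ f [t])) (f [t])"
    proof (cases "snd t")
      case True
      then have "[t] = gen (fst t)"
        by (simp add: gen_def prod_eq_iff)
      moreover have "elementary (fst t) [s] \<one>\<^bsub>F\<^esub>"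
        unfolding elementary_def using s tX neq by (intro conjI exI[of _ s]) auto
      then have "\<not> better num (f [s] \<cdot> f (gen (fst t)) \<cdot> f \<one>\<^bsub>F\<^esub>) (f (gen (fst t)))"
        by (rule move)
      moreover have "f [s] \<cdot> f (gen (fst t)) \<cdot> f \<one>\<^bsub>F\<^esub> = f [s] \<cdot> f (gen (fst t))"
        using gt auto_hom(3)[OF fA] by simp
      ultimately show ?thesis
        by (simp add: mult_free_group)
    next
      case False
      then have "flip (fst t, True) = t"
        by (simp add: flip_def prod_eq_iff)
      then have ft: "f [t] = winv (f (gen (fst t)))"
        using auto_flip[OF fA, of "(fst t, True)"] tX by (simp add: gen_def)
      have "elementary (fst t) \<one>\<^bsub>F\<^esub> [flip s]"
        unfolding elementary_def using s tX neq by (intro conjI exI[of _ "flip s"]) auto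
      then have "\<not> better num (f \<one>\<^bsub>F\<^esub> \<cdot> f (gen (fst t)) \<cdot> f [flip s]) (f (gen (fst t)))"
        by (rule move)
      moreover have "f \<one>\<^bsub>F\<^esub> \<cdot> f (gen (fst t)) \<cdot> f [flip s] = winv (reduce (f [s] @ f [t]))"
        using gt auto_hom(3)[OF fA] auto_flip[OF fA s] ft
        by (simp add: winv_reduce) (simp add: mult_free_group)
      ultimately show ?thesis
        using better_winv[of num "winv (reduce (f [s] @ f [t]))" "f (gen (fst t))"] ft by simp
    qed
  next
    fix s t :: "'a \<times> bool"
    assume s: "fst s \<in> V" and t: "fst t \<in> Y \<union> Z" and neq: "fst s \<noteq> fst t"
    then have tV: "fst t \<in> V"
      by (auto simp: V_iff)
    have gt: "f (gen (fst t)) \<in> carrier F" "f [s] \<in> carrier F"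
      using fF[of s] auto_hom(4)[OF fA, of "gen (fst t)"] s tV by simp_all
    have "elementary (fst t) [s] (\<iota> [s])"
      unfolding elementary_def using s tV neq by (intro conjI exI[of _ s]) auto
    then have "\<not> better num (f [s] \<cdot> f (gen (fst t)) \<cdot> f (\<iota> [s])) (f (gen (fst t)))"
      by (rule move)
    moreover have "f [s] \<cdot> f (gen (fst t)) \<cdot> f (\<iota> [s]) = reduce (f [s] @ f (gen (fst t)) @ winv (f
        [s]))"
      using s gt auto_hom(2)[OF fA, of "[s]"] by (simp add: winv_inv[symmetric]) (simp add:
          mult_free_group)
    ultimately have move': "\<not> better num (reduce (f [s] @ f (gen (fst t)) @ winv (f [s]))) (f (gen
        (fst t)))"
      by simp
    show "\<not> better num (reduce (f [s] @ f [t] @ winv (f [s]))) (f [t])"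
    proof (cases "snd t")
      case True
      then have "[t] = gen (fst t)"
        by (simp add: gen_def prod_eq_iff)
      then show ?thesis
        using move' by simp
    next
      case False
      then have "flip (fst t, True) = t"
        by (simp add: flip_def prod_eq_iff)
      then have ft: "f [t] = winv (f (gen (fst t)))"
        using auto_flip[OF fA, of "(fst t, True)"] tV by (simp add: gen_def)
      have "reduce (f [s] @ f [t] @ winv (f [s])) = winv (reduce (f [s] @ f (gen (fst t)) @ winv (f
          [s])))"
        using ft by (simp add: winv_reduce)
      then show ?thesis
        using move' ft by simp
    qed
  qed
qed

text \<open>Every letter \<open>v\<close> is the image of a word, and by \<open>product_length_one\<close> this word is a signed
  letter \<open>\<sigma> v\<close>. As there are finitely many letters, \<open>\<sigma>\<close> reaches all of them up to sign. A
  peripheral letter is mapped to a conjugate of itself of length one, which is the letter itself.\<close>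
lemma minimal_base_normalizer:
  assumes fin: "finite V" and f: "f \<in> class_preserving"
    and min: "minimal_tuple V (Y \<union> Z) (\<lambda>s. f [s]) num"
  shows "f \<in> base_normalizer"
proof -
  interpret minimal_tuple V "Y \<union> Z" "\<lambda>s. f [s]" num
    by (rule min)
  have fA: "f \<in> auto F"
    using f by (simp add: class_preserving_iff)
  have letter: "\<exists>s. fst s \<in> V \<and> f [s] = gen v" if v: "v \<in> V" for v
  proof -
    have "gen v \<in> f ` carrier F"
      using autoD(2)[OF fA] v by (simp add: bij_betw_def)
    then obtain w where w: "w \<in> carrier F" "f w = gen v"
      by (metis imageE)
    then have "length (reduce (concat (map (\<lambda>s. f [s]) w))) = 1"
      using auto_word[OF fA w(1)] by (simp add: gen_def)
    then obtain s where "w = [s]"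
      using product_length_one[of w] w by (auto simp: in_free_group)
    then show ?thesis
      using w by (intro exI[of _ s]) simp
  qed
  then obtain \<sigma> where \<sigma>: "\<And>v. v \<in> V \<Longrightarrow> fst (\<sigma> v) \<in> V \<and> f [\<sigma> v] = gen v"
    by metis
  have inj: "inj_on (\<lambda>v. fst (\<sigma> v)) V"
  proof (rule inj_onI)
    fix v w
    assume v: "v \<in> V" and w: "w \<in> V" and eq: "fst (\<sigma> v) = fst (\<sigma> w)"
    then consider "\<sigma> w = \<sigma> v" | "\<sigma> w = flip (\<sigma> v)"
      using same_letter[of "\<sigma> v" "\<sigma> w"] by blast
    then show "v = w"
    proof cases
      case 1
      then have "gen w = gen v"
        using \<sigma>[OF v] \<sigma>[OF w] by metis
      then show ?thesis
        by (simp add: gen_def)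
    next
      case 2
      then have "gen w = winv (gen v)"
        using \<sigma>[OF v] \<sigma>[OF w] auto_flip[OF fA, of "\<sigma> v"] by metis
      then show ?thesis
        by (simp add: gen_def flip_def)
    qed
  qed
  then have surj: "(\<lambda>v. fst (\<sigma> v)) ` V = V"
    using fin \<sigma> by (intro endo_inj_surj) auto
  have image: "\<exists>v \<in> V. \<exists>\<epsilon>. f (gen c) = [(v, \<epsilon>)]" if c: "c \<in> V" for c
  proof -
    obtain v where v: "v \<in> V" "c = fst (\<sigma> v)"
      using c surj by blast
    have f\<sigma>: "f [\<sigma> v] = [(v, True)]" "f [flip (\<sigma> v)] = [(v, False)]"
      using \<sigma>[OF v(1)] auto_flip[OF fA, of "\<sigma> v"] by (simp_all add: gen_def flip_def)
    have "gen c = [\<sigma> v] \<or> gen c = [flip (\<sigma> v)]"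
      unfolding v(2) by (cases "\<sigma> v") (auto simp: gen_def flip_def)
    then show ?thesis
      using f\<sigma> v(1) by auto
  qed
  have fixP: "f (gen p) = gen p" if p: "p \<in> Y \<union> Z" for p
  proof -
    obtain A where A: "f (gen p) = A @ [(p, True)] @ winv A"
      using U_peripheral[of "(p, True)"] p by (auto simp: gen_def)
    have "length (f (gen p)) = 1"
      using image[of p] p by (auto simp: V_iff)
    then have "A = []"
      using A by simp
    then show ?thesis
      using A by (simp add: gen_def)
  qed
  show ?thesis
  proof (rule signed_permutation_base_normalizer[OF fA fixP])
    fix x
    assume x: "x \<in> X"
    then have xV: "x \<in> V"
      by (simp add: V_iff)
    then obtain v \<epsilon> where v: "v \<in> V" "f (gen x) = [(v, \<epsilon>)]"
      using image by blast
    have "v \<notin> Y \<union> Z"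
    proof
      assume p: "v \<in> Y \<union> Z"
      have "f [(v, \<epsilon>)] = [(v, \<epsilon>)]"
        using fixP[OF p] auto_flip[OF fA, of "(v, True)"] v(1)
        by (cases \<epsilon>) (simp_all add: gen_def flip_def)
      then have "gen x = [(v, \<epsilon>)]"
        using v(1) xV by (intro auto_inj[OF fA _ _ trans[OF v(2)]]) simp_all
      then show False
        using x p disjoint by (auto simp: gen_def)
    qed
    then show "\<exists>x' \<in> X. \<exists>\<epsilon>. f (gen x) = [(x', \<epsilon>)]"
      using v unfolding V_iff by blast
  qed
qed

text \<open>Induction on the measure of the tuple of images. If an elementary \<open>e\<close> improves \<open>f\<close> and \<open>f e
  = h g\<close>, then \<open>f\<close> is \<open>h g\<close> times the inverse of \<open>e\<close>, and this factor is absorbed on the right by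
  \<open>g\<close>, or else moved past \<open>g\<close> into \<open>h\<close>.\<close>
lemma factorization:
  assumes fin: "finite V" and f: "f \<in> class_preserving"
  shows "\<exists>h \<in> move_group. \<exists>g \<in> base_normalizer. f = h \<otimes>\<^bsub>Aut\<^esub> g"
proof -
  obtain num :: "'a word \<Rightarrow> nat" where
    num: "\<forall>d e r. length d = length e \<longrightarrow> num d < num e \<longrightarrow> num (d @ r) < num (e @ r)"
      "\<forall>d e. length d = length e \<longrightarrow> fst ` set d \<subseteq> V \<longrightarrow> fst ` set e \<subseteq> V \<longrightarrow> num d = num e \<longrightarrow> d = e"
    using exists_word_numbering[OF fin] by (elim exE conjE) (rule that)
  define code where "code w = num (half w) + num (half (winv w))" for w
  define size :: "('a word \<Rightarrow> 'a word) \<Rightarrow> nat \<times> nat"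
    where "size f = (\<Sum>v\<in>V. length (f (gen v)), \<Sum>v\<in>V. code (f (gen v)))" for f
  have "wf (inv_image (less_than <*lex*> less_than) size)"
    by (intro wf_inv_image wf_lex_prod wf_less_than)
  then show ?thesis
    using f
  proof (induction f rule: wf_induct_rule)
    case (less f)
    have fA: "f \<in> auto F" "f \<in> carrier Aut"
      using less.prems by (simp_all add: class_preserving_iff AutoGroup_simps)
    interpret H: subgroup move_group Aut
      by (rule move_group_subgroup)
    show ?case
    proof (cases "\<exists>b u u'. elementary b u u' \<and> better num ((f \<otimes>\<^bsub>Aut\<^esub> transv b u u') (gen b)) (f (gen
        b))")
      case False
      have "minimal_tuple V (Y \<union> Z) (\<lambda>s. f [s]) num"
      proof (rule minimal_or_improvable[OF less.prems])
        show "\<not> better num ((f \<otimes>\<^bsub>Aut\<^esub> transv b u u') (gen b)) (f (gen b))" if "elementary b u u'"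
            for b u u'
          using False that by blast
        show "num (d @ r) < num (e @ r)" if "length d = length e" "num d < num e" for d e r
          using num(1) that by simp
        show "d = e" if "length d = length e" "fst ` set d \<subseteq> V" "fst ` set e \<subseteq> V" "num d = num e"
            for d e
          using num(2)[rule_format, OF that] .
      qed
      then have "f \<in> base_normalizer"
        using fin less.prems by (intro minimal_base_normalizer)
      then show ?thesis
        using fA H.one_closed by (intro bexI[of _ "\<one>\<^bsub>Aut\<^esub>"] bexI[of _ f]) simp_all
    next
      case True
      then obtain b u u' where e: "elementary b u u'"
        and better: "better num ((f \<otimes>\<^bsub>Aut\<^esub> transv b u u') (gen b)) (f (gen b))"
        by blast
      note bu = elementary_avoiding[OF e]
      let ?e = "transv b u u'"
      let ?f = "f \<otimes>\<^bsub>Aut\<^esub> ?e"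
      have eA: "?e \<in> auto F" "?e \<in> carrier Aut"
        using transv_auto[OF bu] by (simp_all add: AutoGroup_simps)
      have other: "?f (gen c) = f (gen c)" if "c \<in> V - {b}" for c
        using that fA eA transv_gen[OF bu, of c] by (simp add: auto_mult)
      have split: "(\<Sum>v\<in>V. \<phi> (g (gen v))) = \<phi> (g (gen b)) + (\<Sum>v\<in>V - {b}. \<phi> (g (gen v)))"
        for \<phi> :: "'a word \<Rightarrow> nat" and g
        using fin bu(1) by (rule sum.remove)
      have rest: "(\<Sum>v\<in>V - {b}. \<phi> (?f (gen v))) = (\<Sum>v\<in>V - {b}. \<phi> (f (gen v)))"
        for \<phi> :: "'a word \<Rightarrow> nat"
        using other by (intro sum.cong) simp_all
      have "(?f, f) \<in> inv_image (less_than <*lex*> less_than) size"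
        using better rest[of length] rest[of code] unfolding size_def better_def code_def[symmetric]
        by (auto simp: split[of length] split[of code])
      moreover have "?f \<in> class_preserving"
        using less.prems elementary_class_preserving[OF e] by (rule class_preserving_mult)
      ultimately obtain h g where hg: "h \<in> move_group" "g \<in> base_normalizer" "?f = h \<otimes>\<^bsub>Aut\<^esub> g"
        using less.IH by blast
      have hgA: "h \<in> carrier Aut" "g \<in> carrier Aut"
        using hg H.subset by (auto simp: base_normalizer_def AutoGroup_simps)
      have "f = ?f \<otimes>\<^bsub>Aut\<^esub> inv\<^bsub>Aut\<^esub> ?e"
        using fA eA by (simp add: Aut.m_assoc)
      then have fhg: "f = h \<otimes>\<^bsub>Aut\<^esub> (g \<otimes>\<^bsub>Aut\<^esub> inv\<^bsub>Aut\<^esub> ?e)"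
        using hg hgA eA by (simp add: Aut.m_assoc)
      show ?thesis
      proof (cases "inv\<^bsub>Aut\<^esub> ?e \<in> base_normalizer")
        case True
        then show ?thesis
          using hg fhg base_normalizer_mult by blast
      next
        case False
        then have eH: "inv\<^bsub>Aut\<^esub> ?e \<in> move_group"
          using elementary_inverse[OF e] by blast
        let ?k = "g \<otimes>\<^bsub>Aut\<^esub> inv\<^bsub>Aut\<^esub> ?e \<otimes>\<^bsub>Aut\<^esub> inv\<^bsub>Aut\<^esub> g"
        have "?k \<in> move_group"
          using hg(2) eH by (simp add: base_normalizer_def)
        moreover have "f = (h \<otimes>\<^bsub>Aut\<^esub> ?k) \<otimes>\<^bsub>Aut\<^esub> g"
          using fhg hgA eA by (simp add: Aut.m_assoc)
        ultimately show ?thesis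
          using hg by blast
      qed
    qed
  qed
qed

end

section \<open>Automorphisms that act trivially on the quotient\<close>

context peripheral_letters
begin

text \<open>Taken as an endomorphism of \<open>F\<close>, the retraction yields representatives of the cosets of the
  normal closure of \<open>Y\<close> inside \<open>F\<close>.\<close>
definition kill_Y :: "'a word \<Rightarrow> 'a word" where
  "kill_Y = eval_word F (\<lambda>a. if a \<in> Y then \<one>\<^bsub>F\<^esub> else gen a)"

lemma kill_Y_hom: "kill_Y \<in> hom F F"
  unfolding kill_Y_def by (rule F.eval_word_hom) auto

sublocale kill: group_hom F F kill_Y
  using kill_Y_hom by unfold_locales

lemma kill_Y_gen: "a \<in> V \<Longrightarrow> kill_Y (gen a) = (if a \<in> Y then \<one>\<^bsub>F\<^esub> else gen a)"
  unfolding kill_Y_def by (subst F.eval_word_gen) auto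

lemma kill_Y_base: "w \<in> base_words \<Longrightarrow> kill_Y w = w"
proof (rule hom_free_group_ext[OF kill_Y_hom _ F.is_group])
  show "(\<lambda>w. w) \<in> hom F F"
    by (simp add: hom_def)
  show "kill_Y (gen a) = gen a" if "a \<in> X \<union> Z" for a
    using that disjoint kill_Y_gen[of a] by (auto simp: V_iff)
qed (auto simp: V_iff)

lemma kill_Y_in_base:
  assumes "w \<in> carrier F"
  shows "kill_Y w \<in> base_words"
proof -
  interpret B: subgroup base_words F
    by (rule base_words_subgroup)
  have "subgroup {w \<in> carrier F. kill_Y w \<in> base_words} F"
  proof (rule F.subgroupI)
    have "\<one>\<^bsub>F\<^esub> \<in> {w \<in> carrier F. kill_Y w \<in> base_words}"
      by simp
    then show "{w \<in> carrier F. kill_Y w \<in> base_words} \<noteq> {}"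
      by blast
  qed auto
  then have "carrier F \<subseteq> {w \<in> carrier F. kill_Y w \<in> base_words}"
  proof (rule subgroup_of_free_group_contains[OF _ subset_refl])
    fix a
    assume a: "a \<in> V"
    then show "gen a \<in> {w \<in> carrier F. kill_Y w \<in> base_words}"
      using kill_Y_gen[OF a] by (auto simp: V_iff)
  qed
  with assms show ?thesis
    by blast
qed

text \<open>For the inclusion from right to left: modulo a normal subgroup that contains \<open>Y\<close>, each word
  is equal to its retraction, because this holds for letters.\<close>
lemma normal_closure_eq: "normal_closure F (gen ` Y) = {w \<in> carrier F. kill_Y w = \<one>\<^bsub>F\<^esub>}"
proof
  have "kernel F F kill_Y \<lhd> F"
    by (rule kill.normal_kernel)
  moreover have "gen ` Y \<subseteq> kernel F F kill_Y"
    using kill_Y_gen by (auto simp: kernel_def V_iff)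
  ultimately show "normal_closure F (gen ` Y) \<subseteq> {w \<in> carrier F. kill_Y w = \<one>\<^bsub>F\<^esub>}"
    unfolding normal_closure_def kernel_def by blast
next
  have "w \<in> M" if M: "M \<lhd> F" "gen ` Y \<subseteq> M" and w: "w \<in> carrier F" "kill_Y w = \<one>\<^bsub>F\<^esub>" for M w
  proof -
    interpret M: normal M F
      by fact
    let ?D = "{w \<in> carrier F. w \<cdot> \<iota> (kill_Y w) \<in> M}"
    have "subgroup ?D F"
    proof (rule F.subgroupI)
      have "\<one>\<^bsub>F\<^esub> \<in> ?D"
        by simp
      then show "?D \<noteq> {}"
        by blast
    next
      fix u
      assume u: "u \<in> ?D"
      then have "\<iota> u \<cdot> \<iota> (u \<cdot> \<iota> (kill_Y u)) \<cdot> u \<in> M"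
        by (intro M.inv_op_closed1) auto
      moreover have "\<iota> u \<cdot> \<iota> (u \<cdot> \<iota> (kill_Y u)) \<cdot> u = \<iota> u \<cdot> \<iota> (kill_Y (\<iota> u))"
        using u by (simp add: F.inv_mult_group F.m_assoc)
      ultimately show "\<iota> u \<in> ?D"
        using u by simp
    next
      fix u v
      assume uv: "u \<in> ?D" "v \<in> ?D"
      then have "(u \<cdot> (v \<cdot> \<iota> (kill_Y v)) \<cdot> \<iota> u) \<cdot> (u \<cdot> \<iota> (kill_Y u)) \<in> M"
        by (simp add: M.inv_op_closed2)
      moreover have "(u \<cdot> (v \<cdot> \<iota> (kill_Y v)) \<cdot> \<iota> u) \<cdot> (u \<cdot> \<iota> (kill_Y u)) = u \<cdot> v \<cdot> \<iota> (kill_Y (u \<cdot> v))"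
        using uv by (simp add: F.inv_mult_group F.m_assoc)
      ultimately show "u \<cdot> v \<in> ?D"
        using uv by simp
    qed auto
    then have "carrier F \<subseteq> ?D"
    proof (rule subgroup_of_free_group_contains[OF _ subset_refl])
      fix a
      assume a: "a \<in> V"
      then show "gen a \<in> ?D"
        using kill_Y_gen[OF a] M(2) by (auto simp: V_iff)
    qed
    then show ?thesis
      using w by auto
  qed
  then show "{w \<in> carrier F. kill_Y w = \<one>\<^bsub>F\<^esub>} \<subseteq> normal_closure F (gen ` Y)"
    unfolding normal_closure_def by blast
qed

lemma coset_eq:
  assumes w: "w \<in> carrier F"
  shows "normal_closure F (gen ` Y) #>\<^bsub>F\<^esub> w = {x \<in> carrier F. kill_Y x = kill_Y w}"
proof
  show "normal_closure F (gen ` Y) #>\<^bsub>F\<^esub> w \<subseteq> {x \<in> carrier F. kill_Y x = kill_Y w}"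
    using w unfolding normal_closure_eq r_coset_def by auto
  show "{x \<in> carrier F. kill_Y x = kill_Y w} \<subseteq> normal_closure F (gen ` Y) #>\<^bsub>F\<^esub> w"
  proof
    fix x
    assume x: "x \<in> {x \<in> carrier F. kill_Y x = kill_Y w}"
    then have "x \<cdot> \<iota> w \<in> normal_closure F (gen ` Y)"
      using w unfolding normal_closure_eq by simp
    moreover have "x = (x \<cdot> \<iota> w) \<cdot> w"
      using x w by (simp add: F.m_assoc)
    ultimately show "x \<in> normal_closure F (gen ` Y) #>\<^bsub>F\<^esub> w"
      unfolding r_coset_def by blast
  qed
qed

text \<open>The action on the quotient is well defined: the retraction of \<open>f w\<close> depends only on the
  retraction of \<open>w\<close>. On letters of \<open>Y\<close> this holds since \<open>f\<close> maps them to conjugates of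
  themselves.\<close>
lemma kill_Y_class_preserving:
  assumes f: "f \<in> class_preserving" and w: "w \<in> carrier F"
  shows "kill_Y (f w) = kill_Y (f (kill_Y w))"
proof -
  have fA: "f \<in> auto F"
    using f by (simp add: class_preserving_iff)
  have "(kill_Y \<circ> f) w = (kill_Y \<circ> f \<circ> kill_Y) w"
  proof (rule hom_free_group_ext[OF _ _ F.is_group subset_refl _ w])
    show kf: "kill_Y \<circ> f \<in> hom F F"
      using autoD(1)[OF fA] kill_Y_hom by (rule hom_compose)
    show "kill_Y \<circ> f \<circ> kill_Y \<in> hom F F"
      using kill_Y_hom kf by (rule hom_compose)
    fix a
    assume a: "a \<in> V"
    show "(kill_Y \<circ> f) (gen a) = (kill_Y \<circ> f \<circ> kill_Y) (gen a)"
    proof (cases "a \<in> Y")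
      case True
      then obtain k where "k \<in> carrier F" "f (gen a) = k \<cdot> gen a \<cdot> \<iota> k"
        using f unfolding class_preserving_iff by blast
      then show ?thesis
        using True a kill_Y_gen[OF a] auto_hom(3)[OF fA] by simp
    next
      case False
      then show ?thesis
        using kill_Y_gen[OF a] by simp
    qed
  qed
  then show ?thesis
    by simp
qed

lemma class_preserving_subgroup: "subgroup class_preserving Aut"
proof (rule Aut.subgroupI)
  show "class_preserving \<subseteq> carrier Aut"
    by (auto simp: class_preserving_def AutoGroup_simps)
  have "\<one>\<^bsub>Aut\<^esub> \<in> class_preserving"
  proof -
    have "\<one>\<^bsub>Aut\<^esub> \<in> auto F"
      using Aut.one_closed by (simp add: AutoGroup_simps(1))
    then show ?thesis
      by (auto simp: class_preserving_def AutoGroup_simps(2) V_iff)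
  qed
  then show "class_preserving \<noteq> {}"
    by blast
next
  fix f
  assume f: "f \<in> class_preserving"
  then have fA: "f \<in> auto F" "inv\<^bsub>Aut\<^esub> f \<in> auto F"
    using Aut_closed by (simp_all add: class_preserving_iff)
  let ?g = "inv\<^bsub>Aut\<^esub> f"
  have "\<exists>j \<in> carrier F. ?g (gen p) = j \<cdot> gen p \<cdot> \<iota> j" if p: "p \<in> Y \<union> Z" for p
  proof -
    have pF: "gen p \<in> carrier F"
      using p by (auto simp: V_iff)
    obtain k where k: "k \<in> carrier F" "f (gen p) = k \<cdot> gen p \<cdot> \<iota> k"
      using f p unfolding class_preserving_iff by blast
    define j where "j = ?g k"
    have j: "j \<in> carrier F"
      using auto_hom(4)[OF fA(2)] k by (simp add: j_def)
    have gp: "?g (gen p) \<in> carrier F"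
      using auto_hom(4)[OF fA(2)] pF by simp
    have "gen p = ?g (k \<cdot> gen p \<cdot> \<iota> k)"
      using inverse_apply(1)[OF fA(1) pF] k by simp
    also have "\<dots> = j \<cdot> ?g (gen p) \<cdot> \<iota> j"
      using k pF by (simp add: auto_hom[OF fA(2)] j_def)
    finally have "\<iota> j \<cdot> gen p \<cdot> \<iota> (\<iota> j) = \<iota> j \<cdot> (j \<cdot> ?g (gen p) \<cdot> \<iota> j) \<cdot> \<iota> (\<iota> j)"
      by simp
    also have "\<dots> = ?g (gen p)"
      using j gp by (simp add: F.m_assoc)
    finally show ?thesis
      using j by (intro bexI[of _ "\<iota> j"]) simp_all
  qed
  then show "?g \<in> class_preserving"
    using fA by (simp add: class_preserving_iff)
qed (rule class_preserving_mult)

lemma image_coset: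
  assumes f: "f \<in> class_preserving" and w: "w \<in> carrier F"
  shows "f ` {x \<in> carrier F. kill_Y x = kill_Y w} = {x \<in> carrier F. kill_Y x = kill_Y (f w)}"
proof
  have fA: "f \<in> auto F"
    using f by (simp add: class_preserving_iff)
  have g: "inv\<^bsub>Aut\<^esub> f \<in> class_preserving"
    using f class_preserving_subgroup by (rule subgroup.m_inv_closed[rotated])
  have cong: "kill_Y (h x) = kill_Y (h v)"
    if "h \<in> class_preserving" "x \<in> carrier F" "v \<in> carrier F" "kill_Y x = kill_Y v" for h x v
    using that kill_Y_class_preserving[of h x] kill_Y_class_preserving[of h v] by simp
  show "f ` {x \<in> carrier F. kill_Y x = kill_Y w} \<subseteq> {x \<in> carrier F. kill_Y x = kill_Y (f w)}"
    using cong[OF f _ w] auto_hom(4)[OF fA] by auto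
  show "{x \<in> carrier F. kill_Y x = kill_Y (f w)} \<subseteq> f ` {x \<in> carrier F. kill_Y x = kill_Y w}"
  proof
    fix x
    assume x: "x \<in> {x \<in> carrier F. kill_Y x = kill_Y (f w)}"
    then have "kill_Y ((inv\<^bsub>Aut\<^esub> f) x) = kill_Y ((inv\<^bsub>Aut\<^esub> f) (f w))"
      using auto_hom(4)[OF fA w] by (intro cong[OF g]) simp_all
    then have "(inv\<^bsub>Aut\<^esub> f) x \<in> {x \<in> carrier F. kill_Y x = kill_Y w}"
      using x w inverse_apply[OF fA] auto_hom(4)[OF Aut_closed(2)[OF fA]] by simp
    moreover have "x = f ((inv\<^bsub>Aut\<^esub> f) x)"
      using x inverse_apply[OF fA] by simp
    ultimately show "x \<in> f ` {x \<in> carrier F. kill_Y x = kill_Y w}"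
      by blast
  qed
qed

text \<open>The induced automorphism of the quotient, which is given by images of cosets, becomes the
  map \<open>w \<mapsto> kill_Y (f w)\<close> on words in \<open>X\<close> and \<open>Z\<close>.\<close>
lemma quotient_action:
  assumes f: "f \<in> class_preserving" and w: "w \<in> base_words"
  defines "coset \<equiv> \<lambda>v \<in> base_words. normal_closure F (gen ` Y) #>\<^bsub>F\<^esub> v"
  shows "inv_into base_words coset (f ` coset w) = kill_Y (f w)"
proof -
  have fw: "f w \<in> carrier F"
    using f w base_words_F auto_hom(4) by (simp add: class_preserving_iff)
  then have kfw: "kill_Y (f w) \<in> base_words"
    by (rule kill_Y_in_base)
  have coset: "coset v = {x \<in> carrier F. kill_Y x = v}" if "v \<in> base_words" for v
    using that by (simp add: coset_def coset_eq base_words_F kill_Y_base)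
  have "inj_on coset base_words"
  proof (rule inj_onI)
    fix u v
    assume u: "u \<in> base_words" and v: "v \<in> base_words" and eq: "coset u = coset v"
    have "u \<in> coset u"
      using u by (simp add: coset base_words_F kill_Y_base)
    then show "u = v"
      using eq u v by (simp add: coset kill_Y_base)
  qed
  moreover have "f ` coset w = coset (kill_Y (f w))"
    using image_coset[OF f base_words_F[OF w]] w kfw by (simp add: coset kill_Y_base)
  ultimately show ?thesis
    using kfw by (simp add: inv_into_f_f)
qed

text \<open>This describes \<open>\<K>\<close> without cosets.\<close>
definition quotient_trivial :: "('a word \<Rightarrow> 'a word) set" where
  "quotient_trivial = {f \<in> class_preserving. \<forall>w \<in> base_words. kill_Y (f w) = w}"

lemma quotient_trivial_iff:
  "f \<in> quotient_trivial \<longleftrightarrow> f \<in> class_preserving \<and> (\<forall>w \<in> carrier F. kill_Y (f w) = kill_Y w)"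
proof
  assume "f \<in> quotient_trivial"
  then have f: "f \<in> class_preserving" and t: "\<And>w. w \<in> base_words \<Longrightarrow> kill_Y (f w) = w"
    by (simp_all add: quotient_trivial_def)
  have "kill_Y (f w) = kill_Y w" if w: "w \<in> carrier F" for w
    using kill_Y_class_preserving[OF f w] t[OF kill_Y_in_base[OF w]] by simp
  with f show "f \<in> class_preserving \<and> (\<forall>w \<in> carrier F. kill_Y (f w) = kill_Y w)"
    by blast
next
  assume "f \<in> class_preserving \<and> (\<forall>w \<in> carrier F. kill_Y (f w) = kill_Y w)"
  then show "f \<in> quotient_trivial"
    by (simp add: quotient_trivial_def base_words_F kill_Y_base)
qed

lemma quotient_trivial_subgroup: "subgroup quotient_trivial Aut"
proof (rule Aut.subgroupI)
  interpret C: subgroup class_preserving Aut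
    by (rule class_preserving_subgroup)
  show "quotient_trivial \<subseteq> carrier Aut"
    using C.subset by (auto simp: quotient_trivial_def)
  have "\<one>\<^bsub>Aut\<^esub> \<in> quotient_trivial"
    using C.one_closed by (simp add: quotient_trivial_iff) (simp add: AutoGroup_simps(2))
  then show "quotient_trivial \<noteq> {}"
    by blast
next
  interpret C: subgroup class_preserving Aut
    by (rule class_preserving_subgroup)
  fix f
  assume f: "f \<in> quotient_trivial"
  then have fA: "f \<in> auto F"
    by (simp add: quotient_trivial_def class_preserving_iff)
  have "kill_Y ((inv\<^bsub>Aut\<^esub> f) w) = kill_Y w" if w: "w \<in> carrier F" for w
  proof -
    have "(inv\<^bsub>Aut\<^esub> f) w \<in> carrier F"
      using auto_hom(4)[OF Aut_closed(2)[OF fA] w] .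
    then have "kill_Y (f ((inv\<^bsub>Aut\<^esub> f) w)) = kill_Y ((inv\<^bsub>Aut\<^esub> f) w)"
      using f by (simp add: quotient_trivial_iff)
    then show ?thesis
      using inverse_apply(2)[OF fA w] by simp
  qed
  then show "inv\<^bsub>Aut\<^esub> f \<in> quotient_trivial"
    using f by (simp add: quotient_trivial_iff)
next
  fix f g
  assume fg: "f \<in> quotient_trivial" "g \<in> quotient_trivial"
  then have A: "f \<in> auto F" "g \<in> auto F"
    by (simp_all add: quotient_trivial_def class_preserving_iff)
  then show "f \<otimes>\<^bsub>Aut\<^esub> g \<in> quotient_trivial"
    using fg class_preserving_mult auto_hom(4)[OF A(2)] by (simp add: quotient_trivial_iff auto_mult)
qed

lemma side_transv_quotient_trivial:
  assumes a: "a \<in> V" "v \<in> V" "v \<noteq> a" and "a \<in> Y \<and> l \<and> r \<or> v \<in> Y \<and> (l \<and> r \<or> a \<in> X \<and> l \<noteq> r)"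
  shows "side_transv l r a (gen v) \<in> quotient_trivial"
proof -
  let ?s = "side_transv l r a (gen v)"
  have "elementary a (if l then gen v else \<one>\<^bsub>F\<^esub>) (if r then \<iota> (gen v) else \<one>\<^bsub>F\<^esub>)"
    unfolding elementary_def using assms
    by (intro conjI exI[of _ "(v, l)"]) (auto simp: letter_word)
  then have C: "?s \<in> class_preserving"
    unfolding side_transv_def by (rule elementary_class_preserving)
  then have sA: "?s \<in> auto F"
    by (simp add: class_preserving_iff)
  have "(kill_Y \<circ> ?s) w = kill_Y w" if w: "w \<in> carrier F" for w
  proof (rule hom_free_group_ext[OF _ kill_Y_hom F.is_group subset_refl _ w])
    show "kill_Y \<circ> ?s \<in> hom F F"
      using kill_Y_hom autoD(1)[OF sA] by (auto intro: hom_compose)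
    fix c
    assume c: "c \<in> V"
    have "kill_Y (gen a) \<in> carrier F" "kill_Y (gen v) \<in> carrier F"
      using a by simp_all
    then show "(kill_Y \<circ> ?s) (gen c) = kill_Y (gen c)"
      using c assms kill_Y_gen[of a] kill_Y_gen[of v]
      by (cases l; cases r) (auto simp: side_transv_def transv_gen)
  qed
  then show ?thesis
    using C by (simp add: quotient_trivial_iff)
qed

lemma kernel_moves_quotient_trivial: "kernel_moves \<subseteq> quotient_trivial"
proof
  fix s
  assume "s \<in> kernel_moves"
  then show "s \<in> quotient_trivial"
  proof (cases rule: kernel_moves_cases)
    case (Y a v)
    then show ?thesis
      using side_transv_quotient_trivial[of a v True True] by (simp add: V_iff)
  next
    case (XZ a y l r)
    then have "y \<noteq> a"
      using disjoint by auto
    then show ?thesis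
      using XZ side_transv_quotient_trivial[of a y l r] by (auto simp: V_iff)
  qed
qed

text \<open>In a factorization \<open>f = h g\<close> of an element of the kernel, \<open>g\<close> is in the kernel too. It maps
  words in \<open>X\<close> and \<open>Z\<close> to such words, which are equal to their retraction, and so it fixes them.\<close>
theorem generate_kernel_moves:
  assumes "finite V"
  shows "generate Aut kernel_moves = quotient_trivial"
proof
  interpret K: subgroup quotient_trivial Aut
    by (rule quotient_trivial_subgroup)
  show sub: "generate Aut kernel_moves \<subseteq> quotient_trivial"
    using kernel_moves_quotient_trivial quotient_trivial_subgroup by (rule Aut.generate_subgroup_incl)
  show "quotient_trivial \<subseteq> generate Aut kernel_moves"
  proof
    fix f
    assume f: "f \<in> quotient_trivial"
    then have "f \<in> class_preserving"
      by (simp add: quotient_trivial_def)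
    then obtain h g where hg: "h \<in> move_group" "g \<in> base_normalizer" "f = h \<otimes>\<^bsub>Aut\<^esub> g"
      using factorization[OF assms] by blast
    have gA: "g \<in> auto F" and hA: "h \<in> carrier Aut"
      using hg move_group_auto by (simp_all add: base_normalizer_def AutoGroup_simps)
    have hK: "h \<in> quotient_trivial"
      using hg sub by (auto simp: move_group_def)
    have "g = inv\<^bsub>Aut\<^esub> h \<otimes>\<^bsub>Aut\<^esub> f"
      using hA gA unfolding hg(3) by (simp add: AutoGroup_simps(1)[symmetric] Aut.inv_solve_left)
    then have gK: "g \<in> quotient_trivial"
      using f hK by simp
    have "g = \<one>\<^bsub>Aut\<^esub>"
    proof (rule auto_ext[OF gA])
      show "\<one>\<^bsub>Aut\<^esub> \<in> auto F"
        using Aut.one_closed by (simp add: AutoGroup_simps(1))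
      fix a
      assume a: "a \<in> V"
      show "g (gen a) = \<one>\<^bsub>Aut\<^esub> (gen a)"
      proof (cases "a \<in> Y")
        case True
        then show ?thesis
          using a hg by (simp add: base_normalizer_def AutoGroup_simps(2))
      next
        case False
        then have ab: "gen a \<in> base_words"
          using a by (auto simp: V_iff)
        then have "g (gen a) \<in> base_words"
          using hg by (simp add: base_normalizer_def)
        then have "g (gen a) = kill_Y (g (gen a))"
          by (rule kill_Y_base[symmetric])
        also have "\<dots> = gen a"
          using gK ab unfolding quotient_trivial_def by blast
        finally have "g (gen a) = gen a" .
        then show ?thesis
          using a by (simp add: AutoGroup_simps(2))
      qed
    qed
    then show "f \<in> generate Aut kernel_moves"
      using hg hA by (simp add: move_group_def)
  qed
qed

end

section \<open>The generators of \<open>\<K>\<close>\<close>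

theorem theorem1:
  fixes n k l :: nat
  shows "finite (S_K n k l) \<and> S_K n k l \<subseteq> carrier (K_nkl n k l)
    \<and> generate (K_nkl n k l) (S_K n k l) = carrier (K_nkl n k l)"
proof -
  interpret peripheral_letters "letters n k l" "Xs n" "Ys k" "Zs l"
    by unfold_locales (auto simp: letters_def Xs_def Ys_def Zs_def)
  have base: "letters n 0 l = Xs n \<union> Zs l"
    by (auto simp: letters_def Ys_def)
  have fin: "finite (Xs n)" "finite (Ys k)" "finite (Zs l)" "finite (letters n k l)"
    by (simp_all add: letters_def Xs_def Ys_def Zs_def)
  have moves: "S_K n k l = kernel_moves"
    by (simp add: S_K_def kernel_moves_def)
  have "kernel_moves \<subseteq>
      (\<lambda>(x, \<epsilon>, y). M_aut (letters n k l) x \<epsilon> y) ` (Xs n \<times> {1, -1} \<times> Ys k)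
      \<union> (\<lambda>(z, y). C_aut (letters n k l) z y) ` (Zs l \<times> Ys k)
      \<union> (\<lambda>(y, v). C_aut (letters n k l) y v) ` (Ys k \<times> letters n k l)"
    unfolding kernel_moves_def by (intro Un_mono) (fastforce simp: image_iff)+
  then have finite: "finite kernel_moves"
    by (rule finite_subset) (use fin in simp)
  have A: "carrier (A_nkl n k l) = class_preserving"
    by (simp add: A_nkl_def F_nkl_def class_preserving_def)
  have "kernel (A_nkl n k l) (A_nkl n 0 l) (rho n k l) = quotient_trivial"
  proof -
    have rho: "rho n k l f = (\<lambda>w \<in> base_words. kill_Y (f w))" if "f \<in> class_preserving" for f
      unfolding rho_def iota_def N_nkl_def F_nkl_def base
      by (rule restrict_ext) (rule quotient_action[OF that])
    have "\<one>\<^bsub>A_nkl n 0 l\<^esub> = (\<lambda>w \<in> base_words. w)"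
      by (simp add: A_nkl_def F_nkl_def AutoGroup_simps base)
    then show ?thesis
      unfolding kernel_def A quotient_trivial_def
      using rho by (auto simp: fun_eq_iff restrict_def split: if_splits)
  qed
  then have K: "K_nkl n k l = Aut\<lparr>carrier := quotient_trivial\<rparr>"
    by (simp add: K_nkl_def A_nkl_def F_nkl_def)
  have "generate (K_nkl n k l) kernel_moves = generate Aut kernel_moves"
    unfolding K using kernel_moves_quotient_trivial quotient_trivial_subgroup
    by (rule Aut.generate_consistent)
  then show ?thesis
    using finite kernel_moves_quotient_trivial generate_kernel_moves[OF fin(4)]
    by (simp add: moves K)
qed

end
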